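(* There exists no encoded-input weak PRF that is evaluated by a $\mathsf{MAJ}\circ\mathsf{THR}$-circuit. That is, for any triple $(\mathsf{f},\mathsf{gen},\mathsf{enc})$ as below in which $\mathsf{f}$ is computed by polynomial-size $\mathsf{MAJ}\circ\mathsf{THR}$-circuits, there is a polynomial $t$ such that $(\mathsf{f},\mathsf{gen},\mathsf{enc})$ is not a $(t,\epsilon)$-encoded-input weak PRF for any negligible $\epsilon$.
   Context: Let $\lambda$ be a security parameter and $n=n(\lambda)$, $\kappa=\kappa(\lambda)$, $m=m(n)$ polynomially bounded. $\mathsf{gen}$ is a polynomial-time algorithm which on input $1^\lambda$ and random coins outputs a key $k\in\{0,1\}^\kappa$; $\mathsf{enc}:\{0,1\}^m\to\{0,1\}^n$ is a polynomial-time (keyless) encoding algorithm; $\mathsf{f}:\{0,1\}^\kappa\times\{0,1\}^n\to\{0,1\}$ is a polynomial-time algorithm. For $h:\{0,1\}^n\to\{0,1\}$, the oracle $\mathrm{EX}_{\mathsf{enc}}(h)$ returns independent samples $\langle\mathsf{enc}(r),h(\mathsf{enc}(r))\rangle$ with $r$ uniform in $\{0,1\}^m$. $(\mathsf{f},\mathsf{gen},\mathsf{enc})$ is a $(t,\epsilon)$-encoded-input weak PRF if for every oracle circuit $C$ of size $t(\lambda)$, $|\Pr_{k\sim\mathsf{gen}(1^\lambda)}[C^{\mathrm{EX}_{\mathsf{enc}}(\mathsf{f}(k,\cdot))}=1]-\Pr_{\psi}[C^{\mathrm{EX}_{\mathsf{enc}}(\psi)}=1]|\le\epsilon(\lambda)$,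 where $\psi$ is a uniformly random function $\{0,1\}^n\to\{0,1\}$. It is evaluated by $\mathsf{MAJ}\circ\mathsf{THR}$ if $\mathsf{f}$ (as a function of key and encoded input together) is computed by a polynomial-size circuit consisting of a top majority gate over linear threshold gates $[\sum_iw_iz_i\ge\theta]$; the complexity of $\mathsf{enc}$ is unrestricted beyond polynomial time.
   Formalization: The formal theorem adds the assumption that the distribution of enc(r) is not concentrated, up to negligible mass, on polynomially many points; without it the claim fails, e.g. for constant enc and f(k,x) = first bit of a uniform key. *)

theory Defs
  imports "HOL-Probability.Probability" "HOL-Computational_Algebra.Polynomial"
begin

definition bitstrings :: "nat \<Rightarrow> bool list set" where
  "bitstrings n = {xs. length xs = n}"

definition uniform_bits :: "nat \<Rightarrow> bool list pmf" where
  "uniform_bits n = pmf_of_set (bitstrings n)"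

definition poly_bounded :: "(nat \<Rightarrow> nat) \<Rightarrow> bool" where
  "poly_bounded g \<longleftrightarrow> (\<exists>p :: nat poly. \<forall>\<eta>. g \<eta> \<le> poly p \<eta>)"

definition negligible_fun :: "(nat \<Rightarrow> real) \<Rightarrow> bool" where
  "negligible_fun \<epsilon> \<longleftrightarrow> (\<forall>c :: nat. \<forall>\<^sub>F \<eta> in sequentially. \<bar>\<epsilon> \<eta>\<bar> < 1 / real \<eta> ^ c)"


subsection \<open>Polynomial-time algorithms\<close>

text \<open>
  Deterministic Turing machines with one two-way infinite tape. States and tape symbols are
  initial segments of the naturals. State 0 is initial and state 1 is halting. Symbol 0 is the
  blank, 1 and 2 stand for the bits, 3 is a separator; a machine may have further symbols.
\<close>

datatype tm = TM (num_states: nat) (num_symbols: nat)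
  (trans: "nat \<Rightarrow> nat \<Rightarrow> nat \<times> nat \<times> int")

definition wf_tm :: "tm \<Rightarrow> bool" where
  "wf_tm M \<longleftrightarrow> 2 \<le> num_states M \<and> 4 \<le> num_symbols M \<and>
     (\<forall>q < num_states M. \<forall>a < num_symbols M. case trans M q a of (q', b, d) \<Rightarrow>
        q' < num_states M \<and> b < num_symbols M \<and> d \<in> {-1, 0, 1})"

text \<open>A configuration consists of the state, the head position and the tape.\<close>

type_synonym tm_config = "nat \<times> int \<times> (int \<Rightarrow> nat)"

definition tm_step :: "tm \<Rightarrow> tm_config \<Rightarrow> tm_config" where
  "tm_step M = (\<lambda>(q, h, T).
     if q = 1 then (q, h, T)
     else case trans M q (T h) of (q', b, d) \<Rightarrow> (q', h + d, T(h := b)))"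

definition initial_config :: "nat list \<Rightarrow> tm_config" where
  "initial_config w =
     (0, 0, \<lambda>i. if 0 \<le> i \<and> nat i < length w then w ! nat i else 0)"

definition bit_symbol :: "bool \<Rightarrow> nat" where
  "bit_symbol b = (if b then 2 else 1)"

text \<open>
  The output is the non-blank word that starts at cell 0. Halting configurations are fixed points
  of the step function, so this says that the machine halts within \<open>t\<close> steps.
\<close>

definition tm_outputs :: "tm \<Rightarrow> nat \<Rightarrow> nat list \<Rightarrow> bool list \<Rightarrow> bool" where
  "tm_outputs M t w ys \<longleftrightarrow> (\<exists>h T. (tm_step M ^^ t) (initial_config w) = (1, h, T) \<and>
     (\<forall>i < length ys. T (int i) = bit_symbol (ys ! i)) \<and> T (int (length ys)) = 0)"

text \<open>The security parameter in unary, followed by the arguments, each preceded by a separator.\<close>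

definition input_word :: "nat \<Rightarrow> bool list list \<Rightarrow> nat list" where
  "input_word \<eta> xss =
     replicate \<eta> (bit_symbol True) @ concat (map (\<lambda>xs. 3 # map bit_symbol xs) xss)"

definition polynomial_time ::
    "(nat \<Rightarrow> bool list list set) \<Rightarrow> (nat \<Rightarrow> bool list list \<Rightarrow> bool list) \<Rightarrow> bool" where
  "polynomial_time I F \<longleftrightarrow> (\<exists>M. \<exists>p :: nat poly. wf_tm M \<and>
     (\<forall>\<eta>. \<forall>xss \<in> I \<eta>. tm_outputs M (poly p \<eta>) (input_word \<eta> xss) (F \<eta> xss)))"


subsection \<open>Majority of linear threshold gates\<close>

type_synonym thr_gate = "(nat \<Rightarrow> real) \<times> real"

definition thr :: "thr_gate \<Rightarrow> bool list \<Rightarrow> bool" where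
  "thr g z \<longleftrightarrow> snd g \<le> (\<Sum>i<length z. fst g i * of_bool (z ! i))"

text \<open>
  The list may contain the same threshold gate repeatedly (parallel wires into the majority gate).
  Ties are resolved to 1.
\<close>

definition maj_thr :: "thr_gate list \<Rightarrow> bool list \<Rightarrow> bool" where
  "maj_thr G z \<longleftrightarrow> length G \<le> 2 * length (filter (\<lambda>g. thr g z) G)"

definition evaluated_by_maj_thr ::
    "(nat \<Rightarrow> nat) \<Rightarrow> (nat \<Rightarrow> nat) \<Rightarrow> (nat \<Rightarrow> bool list \<Rightarrow> bool list \<Rightarrow> bool) \<Rightarrow> bool" where
  "evaluated_by_maj_thr \<kappa> n f \<longleftrightarrow> (\<exists>p :: nat poly. \<forall>\<eta>. \<exists>G. length G \<le> poly p \<eta> \<and>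
     (\<forall>k \<in> bitstrings (\<kappa> \<eta>). \<forall>x \<in> bitstrings (n \<eta>). f \<eta> k x = maj_thr G (k @ x)))"


subsection \<open>Oracle circuits\<close>

text \<open>
  A circuit is a list of gates in topological order. Boolean gates refer to earlier wires by
  number and produce one wire. Each \<open>Query\<close> gate makes a fresh call to the sampling oracle, which
  takes no input, and produces one wire per bit of the answer. The last wire is the output. A
  reference to a wire that does not exist reads as 0.
\<close>

datatype gate = Const bool | Not nat | And nat nat | Or nat nat | Query

definition wire :: "bool list \<Rightarrow> nat \<Rightarrow> bool" where
  "wire ws i \<longleftrightarrow> i < length ws \<and> ws ! i"

primrec eval_gate :: "bool list pmf \<Rightarrow> gate \<Rightarrow> bool list \<Rightarrow> bool list pmf" where
  "eval_gate D (Const b) ws = return_pmf [b]"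
| "eval_gate D (Not i) ws = return_pmf [\<not> wire ws i]"
| "eval_gate D (And i j) ws = return_pmf [wire ws i \<and> wire ws j]"
| "eval_gate D (Or i j) ws = return_pmf [wire ws i \<or> wire ws j]"
| "eval_gate D Query ws = D"

primrec eval_wires :: "bool list pmf \<Rightarrow> gate list \<Rightarrow> bool list \<Rightarrow> bool list pmf" where
  "eval_wires D [] ws = return_pmf ws"
| "eval_wires D (g # gs) ws = bind_pmf (eval_gate D g ws) (\<lambda>vs. eval_wires D gs (ws @ vs))"

definition run_circuit :: "bool list pmf \<Rightarrow> gate list \<Rightarrow> bool pmf" where
  "run_circuit D C = map_pmf (\<lambda>ws. wire ws (length ws - 1)) (eval_wires D C [])"


subsection \<open>Encoded-input weak PRFs\<close>

definition encoded_input :: "nat \<Rightarrow> (bool list \<Rightarrow> bool list) \<Rightarrow> bool list pmf" where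
  "encoded_input m enc = map_pmf enc (uniform_bits m)"

definition example_oracle ::
    "nat \<Rightarrow> (bool list \<Rightarrow> bool list) \<Rightarrow> (bool list \<Rightarrow> bool) \<Rightarrow> bool list pmf" where
  "example_oracle m enc h = map_pmf (\<lambda>x. x @ [h x]) (encoded_input m enc)"

definition random_function :: "nat \<Rightarrow> (bool list \<Rightarrow> bool) pmf" where
  "random_function n = pmf_of_set (bitstrings n \<rightarrow>\<^sub>E UNIV)"

text \<open>
  \<open>keys \<eta>\<close> is the distribution of the key, \<open>n\<close> and \<open>m\<close> are the lengths of encoded inputs and of
  their preimages.
\<close>

definition encoded_input_weak_prf ::
    "(nat \<Rightarrow> nat) \<Rightarrow> (nat \<Rightarrow> real) \<Rightarrow> (nat \<Rightarrow> nat) \<Rightarrow> (nat \<Rightarrow> nat) \<Rightarrow>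
     (nat \<Rightarrow> bool list \<Rightarrow> bool list \<Rightarrow> bool) \<Rightarrow> (nat \<Rightarrow> bool list pmf) \<Rightarrow>
     (nat \<Rightarrow> bool list \<Rightarrow> bool list) \<Rightarrow> bool" where
  "encoded_input_weak_prf t \<epsilon> n m f keys enc \<longleftrightarrow> (\<forall>\<eta>. \<forall>C. length C \<le> t \<eta> \<longrightarrow>
     \<bar>pmf (bind_pmf (keys \<eta>)
              (\<lambda>k. run_circuit (example_oracle (m \<eta>) (enc \<eta>) (f \<eta> k)) C)) True
       - pmf (bind_pmf (random_function (n \<eta>))
              (\<lambda>\<psi>. run_circuit (example_oracle (m \<eta>) (enc \<eta>) \<psi>) C)) True\<bar> \<le> \<epsilon> \<eta>)"

text \<open>
  A family of distributions is concentrated on polynomially many points if sets of polynomial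
  cardinality carry all but a negligible part of its mass. If the encoded inputs are of this kind
  then a PRF on them only has to produce polynomially many pseudorandom bits, and there are such
  PRFs: for constant \<open>enc\<close> the function that returns the first bit of a uniform key, which is a
  single threshold gate, is perfectly indistinguishable from a random function.
\<close>

definition poly_concentrated :: "(nat \<Rightarrow> bool list pmf) \<Rightarrow> bool" where
  "poly_concentrated D \<longleftrightarrow> (\<exists>S. \<exists>p :: nat poly.
     (\<forall>\<eta>. finite (S \<eta>) \<and> card (S \<eta>) \<le> poly p \<eta>) \<and>
     negligible_fun (\<lambda>\<eta>. measure_pmf.prob (D \<eta>) (- S \<eta>)))"

end

theory Submission
  imports Defs
begin

text \<open>
  For a fixed key \<open>k\<close>, every threshold gate of the circuit for \<open>f\<close> compares a linear form in the
  encoded input \<open>x\<close>, which does not depend on \<open>k\<close>, with a number. On a finite sample this number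
  may be replaced by the value of the form at a sample point, so \<open>s\<close> gates and \<open>N\<close> samples leave only
  \<open>s (N + 1)\<close> hypotheses. Since \<open>f k\<close> is the majority of \<open>s\<close> of them (with \<open>s\<close> odd), one of them has
  correlation at least \<open>1 / s\<close> with the labels on the set of distinct sample points. If there are \<open>q\<close>
  distinct points, random labels have this property with probability at most
  \<open>s (N + 1) exp (- q / (4 s\<^sup>2))\<close>, which is small for \<open>q \<ge> 4 s\<^sup>2 \<eta>\<close>. As the encoded inputs are not
  concentrated on \<open>q\<close> points, for infinitely many \<open>\<eta>\<close> a polynomial number of samples contains \<open>q\<close>
  distinct points with probability at least \<open>1 / 2\<close>. The exponential decay in \<open>\<eta>\<close> is needed here:
  \<open>N\<close> depends on the non-concentration exponent, which is only known after \<open>q\<close> has been fixed.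
  Small circuits can evaluate the hypotheses because real weights can be replaced by integers with
  polynomially many bits.
\<close>


subsection \<open>Integer weights\<close>

text \<open>
  The rounding of Frank and Tardos. Dirichlet approximation rounds a real weight vector, scaled so
  that its largest entry is \<open>\<plusminus>1\<close>, to an integer vector \<open>p\<close>. The residual \<open>r\<close> is too small to flip
  the sign of a nonzero \<open>p \<bullet> x\<close>, decides the sign if \<open>p \<bullet> x = 0\<close>, and vanishes at the largest entry,
  so that it has fewer nonzero entries.
\<close>

lemma integer_weights_aux:
  fixes w :: "nat \<Rightarrow> real"
  assumes "card {i. i < v \<and> w i \<noteq> 0} \<le> d"
  shows "\<exists>p :: nat \<Rightarrow> int. (\<forall>i<v. \<bar>p i\<bar> + 1 \<le> (int v * (int v + 1) ^ v + int v + (int v + 1) ^ v + 2) ^ d) \<and>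
    (\<forall>x :: nat \<Rightarrow> int. (\<forall>i<v. \<bar>x i\<bar> \<le> 1) \<longrightarrow>
       sgn (real_of_int (\<Sum>i<v. p i * x i)) = sgn (\<Sum>i<v. w i * x i))"
  using assms
proof (induction d arbitrary: w)
  case 0
  then have "w i = 0" if "i < v" for i
    using that by auto
  then show ?case
    by (intro exI[of _ "\<lambda>_. 0"]) simp
next
  case (Suc d)
  \<comment> \<open>\<open>A\<close> will bound the entries of the rounded vector, and
    \<open>R\<close> is the factor by which the weights grow with each further nonzero
    entry.\<close>
  define A where "A = (int v + 1) ^ v + 1"
  define R where "R = int v * (int v + 1) ^ v + int v + (int v + 1) ^ v + 2"
  have R: "R = (int v + 1) * A + 1"
    by (simp add: R_def A_def algebra_simps)
  have "A \<ge> 1"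
    by (simp add: A_def)
  have "R \<ge> 1"
    using \<open>A \<ge> 1\<close> by (simp add: R)
  show ?case
  proof (cases "\<exists>i<v. w i \<noteq> 0")
    case False
    then have "{i. i < v \<and> w i \<noteq> 0} = {}"
      by auto
    then have "card {i. i < v \<and> w i \<noteq> 0} \<le> d"
      by (metis card.empty le0)
    from Suc.IH[OF this] obtain p where
      p: "\<And>i. i < v \<Longrightarrow> \<bar>p i\<bar> + 1 \<le> R ^ d"
         "\<And>x :: nat \<Rightarrow> int. (\<forall>i<v. \<bar>x i\<bar> \<le> 1) \<Longrightarrow>
            sgn (real_of_int (\<Sum>i<v. p i * x i)) = sgn (\<Sum>i<v. w i * x i)"
      unfolding R_def by blast
    have "R ^ d \<le> R ^ Suc d"
      using \<open>R \<ge> 1\<close> by (simp add: power_increasing)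
    then show ?thesis
      using p unfolding R_def[symmetric] by (intro exI[of _ p]) force
  next
    case True
    define M where "M = Max ((\<lambda>i. \<bar>w i\<bar>) ` {..<v})"
    have "M \<in> (\<lambda>i. \<bar>w i\<bar>) ` {..<v}"
      unfolding M_def using True by (intro Max_in) auto
    then obtain i0 where i0: "i0 < v" "M = \<bar>w i0\<bar>"
      by auto
    have le_M: "\<bar>w i\<bar> \<le> M" if "i < v" for i
      unfolding M_def using that by (intro Max_ge) auto
    have "M > 0"
    proof -
      obtain i where "i < v" "w i \<noteq> 0"
        using True by blast
      then show ?thesis
        using le_M[of i] by linarith
    qed
    define u where "u i = w i / M" for i
    have u_le: "\<bar>u i\<bar> \<le> 1" if "i < v" for i
      using le_M[OF that] \<open>M > 0\<close> by (simp add: u_def)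
    have u0: "\<bar>u i0\<bar> = 1"
      using i0 \<open>M > 0\<close> by (simp add: u_def)
    \<comment> \<open>The precision \<open>1 / (v + 1)\<close> keeps the sum of \<open>v\<close>
      residual terms with \<open>\<bar>x i\<bar> \<le> 1\<close> strictly below 1, the least
      absolute value of a nonzero integer.\<close>
    obtain Q p where Q: "0 < Q" "Q \<le> int (Suc v ^ v)"
      and p: "\<And>i. i < v \<Longrightarrow> \<bar>real_of_int Q * u i - real_of_int (p i)\<bar> < 1 / real (Suc v)"
      using Dirichlet_approx_simult[of "Suc v" v u] by auto
    define r where "r i = real_of_int Q * u i - real_of_int (p i)" for i
    have r: "\<bar>r i\<bar> < 1 / real (Suc v)" if "i < v" for i
      using p[OF that] by (simp add: r_def)
    have r1: "\<bar>r i\<bar> < 1" if "i < v" for i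
    proof -
      have "1 / real (Suc v) \<le> 1"
        by simp
      then show ?thesis
        using r[OF that] by linarith
    qed
    \<comment> \<open>An integral entry has an integral residual below 1. This removes the entry
      \<open>\<plusminus>1\<close> at \<open>i0\<close> and creates no new nonzero entry where
      \<open>w\<close> vanishes, so the induction hypothesis applies to \<open>r\<close>.\<close>
    have r_zero: "r i = 0" if "i < v" "u i \<in> \<int>" for i
    proof -
      have "r i \<in> \<int>"
        using that by (simp add: r_def)
      then show ?thesis
        using r1[OF that(1)] by (rule Ints_nonzero_abs_less1)
    qed
    have "card {i. i < v \<and> r i \<noteq> 0} \<le> card ({i. i < v \<and> w i \<noteq> 0} - {i0})"
    proof (intro card_mono)
      have "u i0 \<in> \<int>"
        using u0 by (cases "u i0 \<ge> 0") (auto simp: minus_equation_iff[of _ 1] eq_commute[of _ "u i0"])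
      then show "{i. i < v \<and> r i \<noteq> 0} \<subseteq> {i. i < v \<and> w i \<noteq> 0} - {i0}"
        using r_zero i0 by (auto simp: u_def)
    qed auto
    also have "\<dots> \<le> d"
      using Suc.prems i0 \<open>M > 0\<close> by (simp add: card_Diff_singleton_if)
    finally have card_r: "card {i. i < v \<and> r i \<noteq> 0} \<le> d" .
    from Suc.IH[OF this] obtain p' where
      p': "\<And>i. i < v \<Longrightarrow> \<bar>p' i\<bar> + 1 \<le> R ^ d"
          "\<And>x :: nat \<Rightarrow> int. (\<forall>i<v. \<bar>x i\<bar> \<le> 1) \<Longrightarrow>
            sgn (real_of_int (\<Sum>i<v. p' i * x i)) = sgn (\<Sum>i<v. r i * x i)"
      unfolding R_def by blast
    define K where "K = R ^ d - 1"
    have "K \<ge> 0"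
      using \<open>R \<ge> 1\<close> by (simp add: K_def)
    have p'_le: "\<bar>p' i\<bar> \<le> K" if "i < v" for i
      using p'(1)[OF that] by (simp add: K_def)
    \<comment> \<open>A lexicographic combination: the sum with weights \<open>p'\<close> is at most
      \<open>v K\<close> in absolute value, so it counts only when the sum with weights
      \<open>p\<close> is zero.\<close>
    define P where "P i = (int v * K + 1) * p i + p' i" for i
    have p_le: "\<bar>p i\<bar> \<le> A" if "i < v" for i
    proof -
      have "\<bar>real_of_int Q * u i\<bar> \<le> real_of_int Q"
        using u_le[OF that] Q by (simp add: abs_mult)
      then have "\<bar>real_of_int (p i)\<bar> < real_of_int Q + 1"
        using r1[OF that] unfolding r_def by linarith
      then have "\<bar>p i\<bar> < Q + 1"
        by linarith
      then show ?thesis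
        using Q(2) by (simp add: A_def add.commute)
    qed
    have P_le: "\<bar>P i\<bar> + 1 \<le> R ^ Suc d" if "i < v" for i
    proof -
      have "\<bar>P i\<bar> \<le> (int v * K + 1) * \<bar>p i\<bar> + \<bar>p' i\<bar>"
        unfolding P_def using \<open>K \<ge> 0\<close> abs_triangle_ineq[of "(int v * K + 1) * p i" "p' i"]
        by (simp add: abs_mult)
      also have "\<dots> \<le> (int v * K + 1) * A + K"
        using \<open>K \<ge> 0\<close> p_le[OF that] p'_le[OF that] by (intro add_mono mult_left_mono) auto
      also have "\<dots> \<le> (K + 1) * R - 1"
      proof -
        have "0 \<le> K * A" "0 \<le> int v * A"
          using \<open>K \<ge> 0\<close> \<open>A \<ge> 1\<close> by simp_all
        then show ?thesis
          unfolding R by (simp add: algebra_simps)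
      qed
      also have "\<dots> = R ^ Suc d - 1"
        by (simp add: K_def)
      finally show ?thesis by simp
    qed
    have "sgn (real_of_int (\<Sum>i<v. P i * x i)) = sgn (\<Sum>i<v. w i * x i)"
      if x: "\<forall>i<v. \<bar>x i\<bar> \<le> 1" for x :: "nat \<Rightarrow> int"
    proof -
      define a where "a = (\<Sum>i<v. p i * x i)"
      define b where "b = (\<Sum>i<v. p' i * x i)"
      define e where "e = (\<Sum>i<v. r i * x i)"
      have P: "(\<Sum>i<v. P i * x i) = (int v * K + 1) * a + b"
        by (simp add: P_def a_def b_def algebra_simps sum.distrib sum_distrib_left)
      have "\<bar>b\<bar> \<le> (\<Sum>i<v. \<bar>p' i * x i\<bar>)"
        unfolding b_def by (rule sum_abs)
      also have "\<dots> \<le> (\<Sum>i<v. K)"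
      proof (rule sum_mono)
        fix i assume "i \<in> {..<v}"
        then show "\<bar>p' i * x i\<bar> \<le> K"
          using p'_le[of i] x mult_mono[of "\<bar>p' i\<bar>" K "\<bar>x i\<bar>" 1] \<open>K \<ge> 0\<close> by (simp add: abs_mult)
      qed
      finally have b: "\<bar>b\<bar> \<le> int v * K"
        by simp
      have "\<bar>e\<bar> \<le> (\<Sum>i<v. \<bar>r i * x i\<bar>)"
        unfolding e_def by (rule sum_abs)
      also have "\<dots> \<le> (\<Sum>i<v. 1 / real (Suc v))"
      proof (rule sum_mono)
        fix i assume i: "i \<in> {..<v}"
        then have "real_of_int \<bar>x i\<bar> \<le> 1"
          using x by (metis lessThan_iff of_int_1 of_int_le_iff)
        then show "\<bar>r i * x i\<bar> \<le> 1 / real (Suc v)"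
          using r[of i] i mult_mono[of "\<bar>r i\<bar>" "1 / real (Suc v)" "\<bar>real_of_int (x i)\<bar>" 1]
          by (simp add: abs_mult)
      qed
      also have "\<dots> < 1"
        by (simp add: field_simps)
      finally have e: "\<bar>e\<bar> < 1" .
      have "Q * (\<Sum>i<v. u i * x i) = e + a"
        by (simp add: e_def a_def r_def algebra_simps sum_distrib_left sum_subtractf)
      moreover have "(\<Sum>i<v. w i * x i) = M * (\<Sum>i<v. u i * x i)"
        using \<open>M > 0\<close> by (simp add: u_def sum_distrib_left)
      then have "sgn (\<Sum>i<v. w i * x i) = sgn (Q * (\<Sum>i<v. u i * x i))"
        using \<open>M > 0\<close> Q(1) by (simp add: sgn_mult)
      ultimately have w: "sgn (\<Sum>i<v. w i * x i) = sgn (e + a)"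
        by simp
      show ?thesis
      proof (cases "a = 0")
        case True
        then show ?thesis
          unfolding w P using p'(2)[OF x] by (simp add: e_def b_def)
      next
        case False
        have "int v * K + 1 \<le> (int v * K + 1) * \<bar>a\<bar>"
          using False \<open>K \<ge> 0\<close> by simp
        then have "\<bar>b\<bar> < (int v * K + 1) * \<bar>a\<bar>"
          using b by linarith
        then have "sgn ((int v * K + 1) * a + b) = sgn a"
          using False by (cases "a > 0") (auto simp: sgn_if)
        moreover have "sgn (e + a) = sgn (real_of_int a)"
          using False e by (cases "a > 0") (auto simp: sgn_if)
        moreover have "sgn (real_of_int z) = real_of_int (sgn z)" for z
          by (simp add: sgn_if)
        ultimately show ?thesis
          unfolding w P by (simp only:)
      qed
    qed
    with P_le show ?thesis
      unfolding R_def[symmetric] by (intro exI[of _ P]) auto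
  qed
qed

text \<open>The rounding with \<open>d = v\<close>, and \<open>v + 1 \<le> 2 ^ v\<close> to turn the
  bound into a power of two. Its exponent is cubic in \<open>v\<close>, so the weights have
  polynomially many bits.\<close>

lemma integer_weights:
  fixes w :: "nat \<Rightarrow> real"
  obtains p :: "nat \<Rightarrow> int" where
    "\<And>i. i < v \<Longrightarrow> \<bar>p i\<bar> \<le> 2 ^ (v * (v * v + v + 2))"
    "\<And>x :: nat \<Rightarrow> int. (\<And>i. i < v \<Longrightarrow> \<bar>x i\<bar> \<le> 1) \<Longrightarrow>
       0 \<le> (\<Sum>i<v. p i * x i) \<longleftrightarrow> 0 \<le> (\<Sum>i<v. w i * x i)"
proof -
  define R where "R = int v * (int v + 1) ^ v + int v + (int v + 1) ^ v + 2"
  have "card {i. i < v \<and> w i \<noteq> 0} \<le> card {..<v}"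
    by (intro card_mono) auto
  then have "card {i. i < v \<and> w i \<noteq> 0} \<le> v"
    by simp
  from integer_weights_aux[OF this] obtain p :: "nat \<Rightarrow> int" where
    p: "\<And>i. i < v \<Longrightarrow> \<bar>p i\<bar> + 1 \<le> R ^ v"
       "\<And>x :: nat \<Rightarrow> int. (\<forall>i<v. \<bar>x i\<bar> \<le> 1) \<Longrightarrow>
            sgn (real_of_int (\<Sum>i<v. p i * x i)) = sgn (\<Sum>i<v. w i * x i)"
    unfolding R_def by blast
  have v: "int v + 1 \<le> 2 ^ v"
    using less_exp[of v] by (metis Suc_leI add.commute of_nat_Suc of_nat_le_iff of_nat_numeral of_nat_power)
  have vv: "(int v + 1) ^ v \<le> 2 ^ (v * v)"
    using power_mono[OF v, of v] by (simp add: power_mult)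
  have "R = (int v + 1) * (int v + 1) ^ v + int v + 2"
    by (simp add: R_def algebra_simps)
  also have "\<dots> \<le> 2 ^ v * 2 ^ (v * v) + 2 ^ v + 1"
    using v mult_mono[OF v vv] by simp
  also have "\<dots> \<le> 2 ^ (v * v + v) + 2 ^ (v * v + v) + 2 ^ (v * v + v)"
    by (intro add_mono) (simp_all add: power_add one_le_power[of 2 "v * v + v", unfolded power_add])
  also have "\<dots> \<le> 2 ^ (v * v + v + 2)"
    by simp
  finally have "R ^ v \<le> (2 ^ (v * v + v + 2)) ^ v"
    by (intro power_mono) (auto simp: R_def)
  also have "\<dots> = 2 ^ (v * (v * v + v + 2))"
    by (metis power_mult mult.commute)
  finally have R: "R ^ v \<le> 2 ^ (v * (v * v + v + 2))" .
  show thesis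
  proof (rule that[of p])
    show "\<bar>p i\<bar> \<le> 2 ^ (v * (v * v + v + 2))" if "i < v" for i
      using p(1)[OF that] R by linarith
    show "0 \<le> (\<Sum>i<v. p i * x i) \<longleftrightarrow> 0 \<le> (\<Sum>i<v. w i * x i)"
      if "\<And>i. i < v \<Longrightarrow> \<bar>x i\<bar> \<le> 1" for x :: "nat \<Rightarrow> int"
    proof -
      have "sgn (real_of_int (\<Sum>i<v. p i * x i)) = sgn (\<Sum>i<v. w i * x i)"
        using p(2) that by blast
      then have "0 \<le> real_of_int (\<Sum>i<v. p i * x i) \<longleftrightarrow> 0 \<le> (\<Sum>i<v. w i * x i)"
        by (smt (verit) sgn_if)
      then show ?thesis
        by (simp only: of_int_0_le_iff)
    qed
  qed
qed


subsection \<open>Circuits\<close>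

text \<open>
  \<open>computes F G c\<close>: from the functions in \<open>F\<close>, \<open>c\<close> gates produce all the functions in \<open>G\<close>. Working
  with sets of functions avoids the bookkeeping of wire numbers.
\<close>

inductive computes :: "('a \<Rightarrow> bool) set \<Rightarrow> ('a \<Rightarrow> bool) set \<Rightarrow> nat \<Rightarrow> bool" for F where
  base: "computes F F 0"
| weaken: "computes F G c \<Longrightarrow> G' \<subseteq> G \<Longrightarrow> c \<le> c' \<Longrightarrow> computes F G' c'"
| const: "computes F G c \<Longrightarrow> computes F (insert (\<lambda>x. b) G) (Suc c)"
| not: "computes F G c \<Longrightarrow> g \<in> G \<Longrightarrow> computes F (insert (\<lambda>x. \<not> g x) G) (Suc c)"
| conj: "computes F G c \<Longrightarrow> g \<in> G \<Longrightarrow> h \<in> G \<Longrightarrow> computes F (insert (\<lambda>x. g x \<and> h x) G) (Suc c)"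
| disj: "computes F G c \<Longrightarrow> g \<in> G \<Longrightarrow> h \<in> G \<Longrightarrow> computes F (insert (\<lambda>x. g x \<or> h x) G) (Suc c)"

text \<open>Gates only add functions and never remove any, so everything available at the start can
  be carried along. Parallel composition rests on this.\<close>

lemma computes_frame:
  assumes "computes F G c"
  shows "computes (F \<union> A) (G \<union> A) c"
  using assms
proof induction
  case base
  show ?case by (rule computes.base)
next
  case (weaken G c G' c')
  then show ?case using computes.weaken[of "F \<union> A" "G \<union> A" c "G' \<union> A" c'] by auto
next
  case (const G c b)
  then show ?case using computes.const[of "F \<union> A" "G \<union> A" c b] by simp
next
  case (not G c g)
  then show ?case using computes.not[of "F \<union> A" "G \<union> A" c g] by simp
next
  case (conj G c g h)
  then show ?case using computes.conj[of "F \<union> A" "G \<union> A" c g h] by simp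
next
  case (disj G c g h)
  then show ?case using computes.disj[of "F \<union> A" "G \<union> A" c g h] by simp
qed

lemma computes_trans:
  assumes "computes G H d" "computes F G c"
  shows "computes F H (c + d)"
  using assms(1)
proof induction
  case base
  then show ?case using assms(2) by simp
next
  case (weaken H c' H' d')
  then show ?case using computes.weaken[of F H "c + c'" H' "c + d'"] by simp
qed (auto intro: computes.const computes.not computes.conj computes.disj)

lemma computes_Un:
  assumes "computes F G c" "computes F H d"
  shows "computes F (G \<union> H) (c + d)"
proof -
  have "computes F (G \<union> F) c"
    using computes_frame[OF assms(1), of F] by simp
  moreover have "computes (G \<union> F) (G \<union> H) d"
    using computes_frame[OF assms(2), of G] by (simp add: Un_commute)
  ultimately show ?thesis
    using computes_trans by blast
qed

lemma computes_UN:
  assumes "finite I" "\<And>i. i \<in> I \<Longrightarrow> computes F (G i) c"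
  shows "computes F (\<Union>i\<in>I. G i) (card I * c)"
  using assms
proof (induction I)
  case empty
  show ?case
    using computes.weaken[OF computes.base[of F], of "{}" 0] by simp
next
  case (insert i I)
  then show ?case
    using computes_Un[of F "G i" c "\<Union>i\<in>I. G i" "card I * c"] by simp
qed

abbreviation "comp1 F f \<equiv> computes F {f}"

lemma comp1_input: "f \<in> F \<Longrightarrow> comp1 F f 0"
  by (rule computes.weaken[OF computes.base]) auto

lemma comp1_mono: "comp1 F f c \<Longrightarrow> c \<le> d \<Longrightarrow> comp1 F f d"
  by (rule computes.weaken) auto

lemma comp1_const: "comp1 F (\<lambda>x. b) 1"
  by (rule computes.weaken[OF computes.const[OF computes.base]]) auto

lemma comp1_not: "comp1 F f c \<Longrightarrow> comp1 F (\<lambda>x. \<not> f x) (c + 1)"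
  by (rule computes.weaken[OF computes.not]) auto

lemma comp1_conj:
  assumes "comp1 F f c" "comp1 F g d"
  shows "comp1 F (\<lambda>x. f x \<and> g x) (c + d + 1)"
  by (rule computes.weaken[OF computes.conj[OF computes_Un[OF assms], of f g]]) auto

lemma comp1_disj:
  assumes "comp1 F f c" "comp1 F g d"
  shows "comp1 F (\<lambda>x. f x \<or> g x) (c + d + 1)"
  by (rule computes.weaken[OF computes.disj[OF computes_Un[OF assms], of f g]]) auto

lemma comp1_eq:
  assumes "comp1 F f c" "comp1 F g d"
  shows "comp1 F (\<lambda>x. f x = g x) (2 * (c + d) + 5)"
proof -
  have "comp1 F (\<lambda>x. (f x \<and> g x) \<or> \<not> (f x \<or> g x)) ((c + d + 1) + (c + d + 1 + 1) + 1)"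
    by (intro comp1_conj comp1_disj comp1_not assms)
  then have "comp1 F (\<lambda>x. (f x \<and> g x) \<or> \<not> (f x \<or> g x)) (2 * (c + d) + 5)"
    by (rule comp1_mono) simp
  moreover have "(\<lambda>x. (f x \<and> g x) \<or> \<not> (f x \<or> g x)) = (\<lambda>x. f x = g x)"
    by auto
  ultimately show ?thesis
    by (simp only:)
qed

lemma comp1_Ball:
  assumes "\<And>i. i < (k::nat) \<Longrightarrow> comp1 F (f i) c"
  shows "comp1 F (\<lambda>x. \<forall>i<k. f i x) (k * (c + 1) + 1)"
  using assms
proof (induction k)
  case 0
  then show ?case using comp1_const[of F True] by simp
next
  case (Suc k)
  have "comp1 F (\<lambda>x. f k x \<and> (\<forall>i<k. f i x)) (c + (k * (c + 1) + 1) + 1)"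
    by (intro comp1_conj Suc.IH Suc.prems) auto
  moreover have "(\<lambda>x. f k x \<and> (\<forall>i<k. f i x)) = (\<lambda>x. \<forall>i<Suc k. f i x)"
    by (auto simp: less_Suc_eq)
  ultimately show ?case
    by (simp add: algebra_simps)
qed

lemma comp1_Bex:
  assumes "\<And>i. i < (k::nat) \<Longrightarrow> comp1 F (f i) c"
  shows "comp1 F (\<lambda>x. \<exists>i<k. f i x) (k * (c + 1) + 1)"
  using assms
proof (induction k)
  case 0
  then show ?case using comp1_const[of F False] by simp
next
  case (Suc k)
  have "comp1 F (\<lambda>x. f k x \<or> (\<exists>i<k. f i x)) (c + (k * (c + 1) + 1) + 1)"
    by (intro comp1_disj Suc.IH Suc.prems) auto
  moreover have "(\<lambda>x. f k x \<or> (\<exists>i<k. f i x)) = (\<lambda>x. \<exists>i<Suc k. f i x)"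
    by (auto simp: less_Suc_eq)
  ultimately show ?case
    by (simp add: algebra_simps)
qed


section \<open>Ripple-carry addition in two's complement and the sign of an integer sum\<close>

definition carry :: "int \<Rightarrow> int \<Rightarrow> nat \<Rightarrow> bool" where
  "carry S P b \<longleftrightarrow> 2 ^ b \<le> take_bit b S + take_bit b P"

lemma carry_0: "carry S P 0 = False"
  by (simp add: carry_def)

lemma carry_Suc:
  "carry S P (Suc b) \<longleftrightarrow> (bit S b \<and> bit P b) \<or> ((bit S b \<or> bit P b) \<and> carry S P b)"
proof -
  obtain s t where st: "s = take_bit b S" "t = take_bit b P"
    by blast
  then have "s < 2 ^ b" "t < 2 ^ b" "0 \<le> s" "0 \<le> t"
    by simp_all
  then show ?thesis
    by (cases "bit S b"; cases "bit P b")
       (auto simp: carry_def take_bit_Suc_from_most st[symmetric])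
qed

text \<open>The sum output of a full adder: two nested equivalences of three truth values give their
  parity. Negative integers are covered, as \<open>take_bit\<close> yields the nonnegative
  remainder.\<close>

lemma bit_add_carry: "bit (S + P) b \<longleftrightarrow> ((bit S b = bit P b) = carry S P b)" for S P :: int
proof -
  define s t where "s = take_bit b S" and "t = take_bit b P"
  have st: "s < 2 ^ b" "t < 2 ^ b" "0 \<le> s" "0 \<le> t"
    by (simp_all add: s_def t_def)
  \<comment> \<open>Bit \<open>b\<close> depends only on the lowest \<open>b + 1\<close> bits of the
    summands. Splitting off their top bits leaves \<open>s + t\<close>, whose overflow is the
    carry.\<close>
  have "bit (S + P) b = bit (take_bit (Suc b) (take_bit (Suc b) S + take_bit (Suc b) P)) b"
    by (simp only: take_bit_add) (simp add: bit_take_bit_iff)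
  also have "\<dots> = bit (take_bit (Suc b) S + take_bit (Suc b) P) b"
    by (simp only: bit_take_bit_iff) simp
  also have "\<dots> = bit (2 ^ b * (of_bool (bit S b) + of_bool (bit P b)) + (s + t)) b"
    by (simp add: take_bit_Suc_from_most s_def t_def algebra_simps)
  also have "\<dots> = odd (of_bool (bit S b) + of_bool (bit P b) + (s + t) div 2 ^ b)"
    by (simp add: bit_iff_odd)
  also have "(s + t) div 2 ^ b = of_bool (carry S P b)"
  proof (cases "carry S P b")
    case True
    then have "(s + t) div 2 ^ b = 1 + (s + t - 2 ^ b) div 2 ^ b"
      using div_add_self2[of "2 ^ b" "s + t - 2 ^ b"] by simp
    also have "(s + t - 2 ^ b) div 2 ^ b = 0"
      using True st by (intro div_pos_pos_trivial) (auto simp: carry_def simp flip: s_def t_def)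
    finally show ?thesis
      using True by simp
  next
    case False
    then show ?thesis
      using st by (auto simp: carry_def simp flip: s_def t_def intro!: div_pos_pos_trivial)
  qed
  finally show ?thesis
    by (cases "bit S b"; cases "bit P b"; cases "carry S P b") auto
qed

lemma computes_adder:
  fixes S :: "'a \<Rightarrow> int" and p :: int
  assumes "\<And>b. b \<le> B \<Longrightarrow> (\<lambda>x. bit (S x) b) \<in> F" "g \<in> F"
  shows "computes F (\<Union>b\<le>B. {\<lambda>x. bit (S x + p * of_bool (g x)) b}) ((B + 1) * 100)"
proof -
  define T where "T b = (\<lambda>x. bit (S x) b)" for b
  define P where "P b = (\<lambda>x. bit (p * of_bool (g x)) b)" for b
  define C where "C b = (\<lambda>x. carry (S x) (p * of_bool (g x)) b)" for b
  have T: "T b \<in> F" if "b \<le> B" for b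
    using assms(1)[OF that] by (simp add: T_def)
  have P_eq: "P b = (\<lambda>x. bit p b \<and> g x)" for b
    by (auto simp: P_def)
  have P: "comp1 F' (P b) 2" if "g \<in> F'" for F' b
    using comp1_conj[OF comp1_const[of F' "bit p b"] comp1_input[OF that]]
    by (simp add: P_eq numeral_2_eq_2)
  have carries: "computes F (F \<union> (\<Union>b\<le>k. {C b})) (10 * k + 1)" if "k \<le> B + 1" for k
    using that
  proof (induction k)
    case 0
    have "computes F (F \<union> {C 0}) (0 + 1)"
      using comp1_const[of F False]
      by (intro computes_Un computes.base) (simp add: C_def carry_0)
    then show ?case by simp
  next
    case (Suc k)
    let ?G = "F \<union> (\<Union>b\<le>k. {C b})"
    have k: "T k \<in> ?G" "C k \<in> ?G" "g \<in> ?G"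
      using T[of k] Suc.prems assms(2) by auto
    have "comp1 ?G (\<lambda>x. (T k x \<and> P k x) \<or> ((T k x \<or> P k x) \<and> C k x)) ((0 + 2 + 1) + ((0 + 2 + 1) + 0 + 1) + 1)"
      by (intro comp1_conj comp1_disj P comp1_input k)
    then have "comp1 ?G (\<lambda>x. (T k x \<and> P k x) \<or> ((T k x \<or> P k x) \<and> C k x)) 8"
      by (rule comp1_mono) simp
    moreover have "(\<lambda>x. (T k x \<and> P k x) \<or> ((T k x \<or> P k x) \<and> C k x)) = C (Suc k)"
      by (simp add: C_def T_def P_def carry_Suc)
    ultimately have "comp1 ?G (C (Suc k)) 8"
      by (simp only:)
    then have "computes ?G (?G \<union> {C (Suc k)}) (0 + 8)"
      by (intro computes_Un computes.base)
    from computes_trans[OF this Suc.IH] have "computes F (?G \<union> {C (Suc k)}) ((10 * k + 1) + (0 + 8))"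
      using Suc.prems by simp
    then have "computes F (?G \<union> {C (Suc k)}) (10 * Suc k + 1)"
      by (rule computes.weaken) auto
    moreover have "?G \<union> {C (Suc k)} = F \<union> (\<Union>b\<le>Suc k. {C b})"
      by (auto simp: le_Suc_eq)
    ultimately show ?case
      by (simp only:)
  qed
  let ?G = "F \<union> (\<Union>b\<le>B + 1. {C b})"
  have "computes ?G (\<Union>b\<le>B. {\<lambda>x. bit (S x + p * of_bool (g x)) b}) (card {..B} * 25)"
  proof (rule computes_UN)
    fix b assume "b \<in> {..B}"
    then have b: "T b \<in> ?G" "C b \<in> ?G" "g \<in> ?G"
      using T[of b] assms(2) by auto
    have "comp1 ?G (\<lambda>x. (T b x = P b x) = C b x) (2 * ((2 * (0 + 2) + 5) + 0) + 5)"
      by (intro comp1_eq P comp1_input b)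
    then have "comp1 ?G (\<lambda>x. (T b x = P b x) = C b x) 25"
      by (rule comp1_mono) simp
    moreover have "(\<lambda>x. (T b x = P b x) = C b x) = (\<lambda>x. bit (S x + p * of_bool (g x)) b)"
      by (simp add: C_def T_def P_def bit_add_carry)
    ultimately show "comp1 ?G (\<lambda>x. bit (S x + p * of_bool (g x)) b) 25"
      by (simp only:)
  qed auto
  from computes_trans[OF this carries] show ?thesis
    by (rule computes.weaken) auto
qed

text \<open>One adder per summand, starting from the hard-wired constant \<open>c\<close>. The set
  \<open>F\<close> is kept in the result because later adders still read their switches from
  it.\<close>

lemma computes_sum_bits:
  fixes p :: "nat \<Rightarrow> int"
  assumes "\<And>i. i < v \<Longrightarrow> g i \<in> F"
  shows "computes F (F \<union> (\<Union>b\<le>B. {\<lambda>x. bit (c + (\<Sum>i<v. p i * of_bool (g i x))) b})) ((v + 1) * ((B + 1) * 100))"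
  using assms
proof (induction v)
  case 0
  have "computes F (\<Union>b\<le>B. {\<lambda>x. bit c b}) (card {..B} * 1)"
    by (intro computes_UN comp1_const) auto
  then have "computes F (F \<union> (\<Union>b\<le>B. {\<lambda>x. bit c b})) (0 + card {..B} * 1)"
    by (intro computes_Un computes.base)
  then show ?case
    by (rule computes.weaken) auto
next
  case (Suc v)
  let ?G = "\<lambda>v. F \<union> (\<Union>b\<le>B. {\<lambda>x. bit (c + (\<Sum>i<v. p i * of_bool (g i x))) b})"
  have "computes (?G v) (\<Union>b\<le>B. {\<lambda>x. bit ((c + (\<Sum>i<v. p i * of_bool (g i x))) + p v * of_bool (g v x)) b}) ((B + 1) * 100)"
    using Suc.prems by (intro computes_adder) auto
  then have "computes (?G v) (?G v \<union> (\<Union>b\<le>B. {\<lambda>x. bit ((c + (\<Sum>i<v. p i * of_bool (g i x))) + p v * of_bool (g v x)) b})) (0 + (B + 1) * 100)"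
    by (intro computes_Un computes.base)
  then have "computes F (?G v \<union> (\<Union>b\<le>B. {\<lambda>x. bit ((c + (\<Sum>i<v. p i * of_bool (g i x))) + p v * of_bool (g v x)) b}))
    ((v + 1) * ((B + 1) * 100) + (0 + (B + 1) * 100))"
    using Suc.prems by (intro computes_trans[OF _ Suc.IH]) auto
  then show ?case
    by (rule computes.weaken) (auto simp: add.assoc)
qed

text \<open>The sign of the sum is read off bit \<open>B\<close> of its two's complement representation.\<close>

lemma comp1_int_threshold:
  fixes p :: "nat \<Rightarrow> int"
  assumes "\<And>i. i < v \<Longrightarrow> comp1 F (g i) d"
    and "\<bar>c\<bar> + (\<Sum>i<v. \<bar>p i\<bar>) < 2 ^ B"
  shows "comp1 F (\<lambda>x. 0 \<le> c + (\<Sum>i<v. p i * of_bool (g i x))) (v * d + (v + 1) * ((B + 1) * 100) + 1)"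
proof -
  define G where "G = (\<Union>i<v. {g i})"
  have 1: "computes F G (v * d)"
    using computes_UN[of "{..<v}" F "\<lambda>i. {g i}" d] assms(1) by (simp add: G_def)
  have "computes G (G \<union> (\<Union>b\<le>B. {\<lambda>x. bit (c + (\<Sum>i<v. p i * of_bool (g i x))) b})) ((v + 1) * ((B + 1) * 100))"
    by (intro computes_sum_bits) (auto simp: G_def)
  then have "comp1 G (\<lambda>x. bit (c + (\<Sum>i<v. p i * of_bool (g i x))) B) ((v + 1) * ((B + 1) * 100))"
    by (rule computes.weaken) auto
  then have "comp1 F (\<lambda>x. \<not> bit (c + (\<Sum>i<v. p i * of_bool (g i x))) B) (v * d + (v + 1) * ((B + 1) * 100) + 1)"
    by (intro comp1_not computes_trans[OF _ 1])
  moreover have "\<not> bit (c + (\<Sum>i<v. p i * of_bool (g i x))) B \<longleftrightarrow> 0 \<le> c + (\<Sum>i<v. p i * of_bool (g i x))" for x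
  proof -
    define S where "S = c + (\<Sum>i<v. p i * of_bool (g i x))"
    have "\<bar>\<Sum>i<v. p i * of_bool (g i x)\<bar> \<le> (\<Sum>i<v. \<bar>p i * of_bool (g i x)\<bar>)"
      by (rule sum_abs)
    also have "\<dots> \<le> (\<Sum>i<v. \<bar>p i\<bar>)"
      by (intro sum_mono) auto
    finally have S: "\<bar>S\<bar> < 2 ^ B"
      using assms(2) unfolding S_def by linarith
    \<comment> \<open>As \<open>\<bar>S\<bar> < 2 ^ B\<close>, the quotient
      \<open>S div 2 ^ B\<close> is 0 or -1, and bit \<open>B\<close> is its parity.\<close>
    have "bit S B \<longleftrightarrow> S < 0"
    proof (cases "S < 0")
      case True
      have "S div 2 ^ B = -1"
        using S True by (intro int_div_pos_eq[of _ _ _ "S + 2 ^ B"]) auto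
      then show ?thesis
        using True by (simp add: bit_iff_odd)
    next
      case False
      then show ?thesis
        using S by (simp add: bit_iff_odd)
    qed
    then show ?thesis
      unfolding S_def by auto
  qed
  ultimately show ?thesis
    by simp
qed

section \<open>From sets of computed functions to oracle circuits\<close>

lemma eval_wires_append:
  "eval_wires D (gs @ hs) ws = bind_pmf (eval_wires D gs ws) (eval_wires D hs)"
  by (induction gs arbitrary: ws) (simp_all add: bind_return_pmf bind_assoc_pmf)

text \<open>Quantifying over every \<open>D\<close> makes the run deterministic whatever the oracle
  is. The common length \<open>l\<close> lets one wire number serve all inputs in
  \<open>X\<close>.\<close>

definition evaluates_to ::
    "'a set \<Rightarrow> ('a \<Rightarrow> bool list) \<Rightarrow> gate list \<Rightarrow> ('a \<Rightarrow> bool list) \<Rightarrow> nat \<Rightarrow> bool" where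
  "evaluates_to X inp gs W l \<longleftrightarrow>
     (\<forall>x\<in>X. length (W x) = l \<and> (\<forall>D. eval_wires D gs (inp x) = return_pmf (W x)))"

definition on_wires :: "'a set \<Rightarrow> ('a \<Rightarrow> bool list) \<Rightarrow> nat \<Rightarrow> ('a \<Rightarrow> bool) set \<Rightarrow> bool" where
  "on_wires X W l G \<longleftrightarrow> (\<forall>g\<in>G. \<exists>i<l. \<forall>x\<in>X. W x ! i = g x)"

lemma on_wiresE:
  assumes "on_wires X W l G" "g \<in> G" "evaluates_to X inp gs W l"
  obtains i where "\<And>x. x \<in> X \<Longrightarrow> wire (W x) i = g x"
proof -
  from assms(1,2) obtain i where i: "i < l" "\<forall>x\<in>X. W x ! i = g x"
    unfolding on_wires_def by blast
  then have "wire (W x) i = g x" if "x \<in> X" for x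
    using assms(3) that by (simp add: wire_def evaluates_to_def)
  then show thesis
    by (rule that)
qed

lemma evaluates_to_snoc:
  assumes "evaluates_to X inp gs W l" "on_wires X W l G"
    and gt: "\<And>x D. x \<in> X \<Longrightarrow> eval_gate D gt (W x) = return_pmf [h x]"
  shows "evaluates_to X inp (gs @ [gt]) (\<lambda>x. W x @ [h x]) (Suc l)"
    and "on_wires X (\<lambda>x. W x @ [h x]) (Suc l) (insert h G)"
proof -
  show "evaluates_to X inp (gs @ [gt]) (\<lambda>x. W x @ [h x]) (Suc l)"
    using assms(1) gt by (simp add: evaluates_to_def eval_wires_append bind_return_pmf)
  have l: "length (W x) = l" if "x \<in> X" for x
    using assms(1) that by (simp add: evaluates_to_def)
  show "on_wires X (\<lambda>x. W x @ [h x]) (Suc l) (insert h G)"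
    unfolding on_wires_def
  proof
    fix g assume "g \<in> insert h G"
    then consider "g = h" | "g \<in> G"
      by blast
    then show "\<exists>i<Suc l. \<forall>x\<in>X. (W x @ [h x]) ! i = g x"
    proof cases
      case 1
      have "\<forall>x\<in>X. (W x @ [h x]) ! l = g x"
        unfolding 1 using l by (metis nth_append_length)
      then show ?thesis
        by blast
    next
      case 2
      then obtain i where i: "i < l" "\<forall>x\<in>X. W x ! i = g x"
        using assms(2) unfolding on_wires_def by blast
      have "\<forall>x\<in>X. (W x @ [h x]) ! i = g x"
      proof
        fix x assume "x \<in> X"
        then show "(W x @ [h x]) ! i = g x"
          using i l[of x] by (simp add: nth_append)
      qed
      then show ?thesis
        using i(1) less_SucI by blast
    qed
  qed
qed

text \<open>Induction on the derivation: each rule that builds a new function appends one gate,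
  whose inputs are located through \<open>on_wires\<close>.\<close>

lemma computes_eval_wires:
  assumes "computes F G c"
    and "evaluates_to X inp [] inp k" "on_wires X inp k F"
  shows "\<exists>gs W l. length gs \<le> c \<and> evaluates_to X inp gs W l \<and> on_wires X W l G"
  using assms(1)
proof induction
  case base
  then show ?case
    using assms(2,3) by (metis le0 list.size(3))
next
  case (weaken G c G' c')
  then obtain gs W l where "length gs \<le> c" "evaluates_to X inp gs W l" "on_wires X W l G"
    by blast
  moreover have "on_wires X W l G'"
    using \<open>on_wires X W l G\<close> weaken.hyps(2) unfolding on_wires_def by blast
  ultimately show ?case
    using weaken.hyps(3) le_trans by blast
next
  case (const G c b)
  then obtain gs W l where gs: "length gs \<le> c" and W: "evaluates_to X inp gs W l" "on_wires X W l G"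
    by blast
  have "eval_gate D (Const b) (W x) = return_pmf [b]" for x D
    by simp
  from evaluates_to_snoc[OF W this] show ?case
    using gs by (intro exI[of _ "gs @ [Const b]"] exI[of _ "\<lambda>x. W x @ [b]"] exI[of _ "Suc l"]) simp
next
  case (not G c g)
  then obtain gs W l where gs: "length gs \<le> c" and W: "evaluates_to X inp gs W l" "on_wires X W l G"
    by blast
  obtain i where "\<And>x. x \<in> X \<Longrightarrow> wire (W x) i = g x"
    using on_wiresE[OF W(2) not.hyps(2) W(1)] by blast
  then have "eval_gate D (gate.Not i) (W x) = return_pmf [\<not> g x]" if "x \<in> X" for x D
    using that by simp
  from evaluates_to_snoc[OF W this] show ?case
    using gs by (intro exI[of _ "gs @ [gate.Not i]"] exI[of _ "\<lambda>x. W x @ [\<not> g x]"] exI[of _ "Suc l"]) simp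
next
  case (conj G c g h)
  then obtain gs W l where gs: "length gs \<le> c" and W: "evaluates_to X inp gs W l" "on_wires X W l G"
    by blast
  obtain i where "\<And>x. x \<in> X \<Longrightarrow> wire (W x) i = g x"
    using on_wiresE[OF W(2) conj.hyps(2) W(1)] by blast
  moreover obtain j where "\<And>x. x \<in> X \<Longrightarrow> wire (W x) j = h x"
    using on_wiresE[OF W(2) conj.hyps(3) W(1)] by blast
  ultimately have "eval_gate D (gate.And i j) (W x) = return_pmf [g x \<and> h x]" if "x \<in> X" for x D
    using that by simp
  from evaluates_to_snoc[OF W this] show ?case
    using gs by (intro exI[of _ "gs @ [gate.And i j]"] exI[of _ "\<lambda>x. W x @ [g x \<and> h x]"] exI[of _ "Suc l"]) simp
next
  case (disj G c g h)
  then obtain gs W l where gs: "length gs \<le> c" and W: "evaluates_to X inp gs W l" "on_wires X W l G"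
    by blast
  obtain i where "\<And>x. x \<in> X \<Longrightarrow> wire (W x) i = g x"
    using on_wiresE[OF W(2) disj.hyps(2) W(1)] by blast
  moreover obtain j where "\<And>x. x \<in> X \<Longrightarrow> wire (W x) j = h x"
    using on_wiresE[OF W(2) disj.hyps(3) W(1)] by blast
  ultimately have "eval_gate D (gate.Or i j) (W x) = return_pmf [g x \<or> h x]" if "x \<in> X" for x D
    using that by simp
  from evaluates_to_snoc[OF W this] show ?case
    using gs by (intro exI[of _ "gs @ [gate.Or i j]"] exI[of _ "\<lambda>x. W x @ [g x \<or> h x]"] exI[of _ "Suc l"]) simp
qed

lemma eval_wires_queries:
  "eval_wires D (replicate N Query) ws = map_pmf (\<lambda>zs. ws @ concat zs) (replicate_pmf N D)"
  by (induction N arbitrary: ws) (simp_all add: map_bind_pmf map_pmf_def bind_assoc_pmf bind_return_pmf)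

lemma nth_concat_uniform:
  assumes "\<And>z. z \<in> set zs \<Longrightarrow> length z = k" "j < length zs" "a < k"
  shows "concat zs ! (j * k + a) = zs ! j ! a"
  using assms
proof (induction zs arbitrary: j)
  case (Cons z zs)
  then show ?case
    by (cases j) (auto simp: nth_append)
qed auto

lemma length_concat_uniform:
  "(\<And>z. z \<in> set zs \<Longrightarrow> length z = k) \<Longrightarrow> length (concat zs) = length zs * k"
  by (induction zs) auto

text \<open>All \<open>N\<close> queries are made first, so bit \<open>a\<close> of sample
  \<open>j\<close> sits on wire \<open>j * k + a\<close> and the rest of the circuit is
  deterministic.\<close>

lemma comp1_run_circuit:
  assumes "comp1 {\<lambda>zs. zs ! j ! a | j a. j < N \<and> a < k} test c"
  obtains C where "length C \<le> N + c + 1"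
    "\<And>D. (\<And>z. z \<in> set_pmf D \<Longrightarrow> length z = k) \<Longrightarrow> run_circuit D C = map_pmf test (replicate_pmf N D)"
proof -
  define X where "X = {zs :: bool list list. length zs = N \<and> (\<forall>z\<in>set zs. length z = k)}"
  have "evaluates_to X concat [] concat (N * k)"
    by (auto simp: evaluates_to_def X_def length_concat_uniform)
  moreover have "on_wires X concat (N * k) {\<lambda>zs. zs ! j ! a | j a. j < N \<and> a < k}"
    unfolding on_wires_def
  proof
    fix f :: "bool list list \<Rightarrow> bool" assume "f \<in> {\<lambda>zs. zs ! j ! a | j a. j < N \<and> a < k}"
    then obtain j a where ja: "f = (\<lambda>zs. zs ! j ! a)" "j < N" "a < k"
      by blast
    have "j * k + a < Suc j * k"
      using ja by simp
    also have "\<dots> \<le> N * k"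
      using ja by (intro mult_right_mono) auto
    finally show "\<exists>i<N * k. \<forall>x\<in>X. concat x ! i = f x"
      using ja by (intro exI[of _ "j * k + a"]) (auto simp: X_def nth_concat_uniform)
  qed
  ultimately obtain gs W l where gs: "length gs \<le> c" and W: "evaluates_to X concat gs W l" "on_wires X W l {test}"
    using computes_eval_wires[OF assms] by blast
  obtain i where i: "\<And>x. x \<in> X \<Longrightarrow> wire (W x) i = test x"
    using on_wiresE[OF W(2) _ W(1)] by blast
  \<comment> \<open>The output is read from the last wire, whereas the result of \<open>test\<close>
    may sit on any wire; \<open>And i i\<close> copies it to the end.\<close>
  have eval: "eval_wires D (gs @ [And i i]) (concat x) = return_pmf (W x @ [test x])" if "x \<in> X" for x D
    using W(1) i that by (simp add: evaluates_to_def eval_wires_append bind_return_pmf)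
  define C where "C = replicate N Query @ gs @ [And i i]"
  show thesis
  proof (rule that[of C])
    show "length C \<le> N + c + 1"
      using gs by (simp add: C_def)
    fix D :: "bool list pmf"
    assume D: "\<And>z. z \<in> set_pmf D \<Longrightarrow> length z = k"
    have "run_circuit D C = bind_pmf (replicate_pmf N D)
       (\<lambda>x. map_pmf (\<lambda>ws. wire ws (length ws - 1)) (eval_wires D (gs @ [And i i]) (concat x)))"
      by (simp add: run_circuit_def C_def eval_wires_append eval_wires_queries map_bind_pmf bind_map_pmf)
    also have "\<dots> = bind_pmf (replicate_pmf N D) (\<lambda>x. return_pmf (test x))"
    proof (rule bind_pmf_cong[OF refl])
      fix x assume "x \<in> set_pmf (replicate_pmf N D)"
      then have x: "x \<in> X"
        using D by (auto simp: set_replicate_pmf X_def)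
      show "map_pmf (\<lambda>ws. wire ws (length ws - 1)) (eval_wires D (gs @ [And i i]) (concat x)) = return_pmf (test x)"
        by (simp add: eval[OF x] wire_def)
    qed
    finally show "run_circuit D C = map_pmf test (replicate_pmf N D)"
      by (simp add: map_pmf_def)
  qed
qed


subsection \<open>The statistical test\<close>

text \<open>
  A sample is a bit string of length \<open>n + 1\<close> whose last bit is the label.
\<close>

definition fresh :: "nat \<Rightarrow> bool list list \<Rightarrow> nat \<Rightarrow> bool" where
  "fresh n zs j \<longleftrightarrow> (\<forall>l<j. \<not> (\<forall>a<n. zs ! l ! a = zs ! j ! a))"

definition linear_form :: "nat \<Rightarrow> (nat \<Rightarrow> real) \<Rightarrow> bool list \<Rightarrow> real" where
  "linear_form n u z = (\<Sum>a<n. u a * of_bool (z ! a))"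

text \<open>The index \<open>l = N\<close> stands for the threshold that no input reaches.\<close>

definition sample_threshold ::
    "nat \<Rightarrow> nat \<Rightarrow> (nat \<Rightarrow> real) \<Rightarrow> nat \<Rightarrow> bool list list \<Rightarrow> bool list \<Rightarrow> bool" where
  "sample_threshold n N u l zs z \<longleftrightarrow> l < N \<and> linear_form n u (zs ! l) \<le> linear_form n u z"

text \<open>
  Each distinct sample point contributes \<open>s - 1\<close> if the hypothesis agrees with its label and
  \<open>- s - 1\<close> otherwise, so that the test asks for a correlation of at least \<open>1 / s\<close>.
\<close>

definition fits :: "nat \<Rightarrow> nat \<Rightarrow> nat \<Rightarrow> (nat \<Rightarrow> real) \<Rightarrow> nat \<Rightarrow> bool list list \<Rightarrow> bool" where
  "fits n N s u l zs \<longleftrightarrow> 0 \<le> (\<Sum>j<N. of_bool (fresh n zs j) *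
     (2 * int s * of_bool (sample_threshold n N u l zs (zs ! j) = zs ! j ! n) - (int s + 1)))"

text \<open>The demand for \<open>q\<close> distinct points prevents acceptance of random labels on
  samples so poor that some hypothesis fits them by chance.\<close>

definition sample_test :: "nat \<Rightarrow> nat \<Rightarrow> nat \<Rightarrow> nat \<Rightarrow> (nat \<Rightarrow> nat \<Rightarrow> real) \<Rightarrow> bool list list \<Rightarrow> bool" where
  "sample_test n N q s u zs \<longleftrightarrow> int q \<le> (\<Sum>j<N. of_bool (fresh n zs j)) \<and>
     (\<exists>g<s. \<exists>l<Suc N. fits n N s (u g) l zs)"

definition fresh_size :: "nat \<Rightarrow> nat \<Rightarrow> nat" where
  "fresh_size n N = N * (6 * n + 3) + 1"

text \<open>Two samples are compared, hence \<open>v = 2 n\<close> inputs. The exponent of the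
  weight bound from \<open>integer_weights\<close> is increased by \<open>v\<close> to accommodate
  the sum of \<open>v\<close> weights.\<close>

definition threshold_size :: "nat \<Rightarrow> nat" where
  "threshold_size n = (let v = 2 * n in (v + 1) * ((v * (v * v + v + 2) + v + 1) * 100) + 1)"

definition agree_size :: "nat \<Rightarrow> nat \<Rightarrow> nat" where
  "agree_size n N = fresh_size n N + (2 * threshold_size n + 5) + 1"

definition fits_size :: "nat \<Rightarrow> nat \<Rightarrow> nat \<Rightarrow> nat" where
  "fits_size n N s = 2 * N * agree_size n N + (2 * N + 1) * ((N * (3 * s + 1) + 1) * 100) + 1"

definition test_size :: "nat \<Rightarrow> nat \<Rightarrow> nat \<Rightarrow> nat \<Rightarrow> nat" where
  "test_size n N q s = (N * fresh_size n N + (N + 1) * ((q + N + 1) * 100) + 1)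
     + (s * ((Suc N * (fits_size n N s + 1) + 1) + 1) + 1) + 1"

text \<open>Serves to feed two blocks of \<open>k\<close> inputs into one threshold
  computation.\<close>

lemma sum_lessThan_double:
  "(\<Sum>i<2 * k. f i) = (\<Sum>i<k. f i) + (\<Sum>i<k. f (k + i))" for k :: nat and f :: "nat \<Rightarrow> 'b::comm_monoid_add"
proof -
  have "{..<2 * k} = {..<k} \<union> (\<lambda>i. k + i) ` {..<k}"
  proof (intro equalityI subsetI)
    fix i assume "i \<in> {..<2 * k}"
    then show "i \<in> {..<k} \<union> (\<lambda>i. k + i) ` {..<k}"
      by (cases "i < k") (auto intro!: image_eqI[of _ _ "i - k"])
  qed auto
  also have "sum f \<dots> = sum f {..<k} + sum f ((\<lambda>i. k + i) ` {..<k})"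
    by (intro sum.union_disjoint) auto
  finally show ?thesis
    by (simp add: sum.reindex)
qed

section \<open>Circuits for the components of the test\<close>

context
  fixes n N :: nat and F :: "(bool list list \<Rightarrow> bool) set"
  assumes F: "F = {\<lambda>zs. zs ! j ! a | j a. j < N \<and> a < n + 1}"
begin

lemma comp1_bit: "j < N \<Longrightarrow> a < n + 1 \<Longrightarrow> comp1 F (\<lambda>zs. zs ! j ! a) 0"
  by (rule comp1_input) (auto simp: F)

lemma comp1_fresh:
  assumes "j < N"
  shows "comp1 F (\<lambda>zs. fresh n zs j) (fresh_size n N)"
proof -
  have "comp1 F (\<lambda>zs. \<forall>l<j. \<not> (\<forall>a<n. zs ! l ! a = zs ! j ! a)) (j * ((n * ((2 * (0 + 0) + 5) + 1) + 1 + 1) + 1) + 1)"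
    using assms by (intro comp1_Ball comp1_not comp1_eq comp1_bit) auto
  then have "comp1 F (\<lambda>zs. \<forall>l<j. \<not> (\<forall>a<n. zs ! l ! a = zs ! j ! a)) (fresh_size n N)"
  proof (rule comp1_mono)
    have "j * (6 * n + 3) \<le> N * (6 * n + 3)"
      using assms by (intro mult_right_mono) auto
    then show "j * ((n * ((2 * (0 + 0) + 5) + 1) + 1 + 1) + 1) + 1 \<le> fresh_size n N"
      by (simp add: fresh_size_def algebra_simps)
  qed
  then show ?thesis
    by (simp only: fresh_def)
qed

text \<open>Since the threshold is itself the value of the form at a sample, the condition is the
  sign of a homogeneous form in \<open>2 n\<close> bits with weights \<open>u\<close> and
  \<open>- u\<close>. The rounding to integer weights applies directly.\<close>

lemma comp1_sample_threshold:
  assumes "j < N"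
  shows "comp1 F (\<lambda>zs. sample_threshold n N u l zs (zs ! j)) (threshold_size n)"
proof (cases "l < N")
  case False
  have "comp1 F (\<lambda>zs. False) (threshold_size n)"
    by (rule comp1_mono[OF comp1_const]) (simp add: threshold_size_def Let_def)
  then show ?thesis
    using False by (simp add: sample_threshold_def)
next
  case True
  define v where "v = 2 * n"
  obtain p :: "nat \<Rightarrow> int" where
    p: "\<And>i. i < v \<Longrightarrow> \<bar>p i\<bar> \<le> 2 ^ (v * (v * v + v + 2))"
    "\<And>x :: nat \<Rightarrow> int. (\<And>i. i < v \<Longrightarrow> \<bar>x i\<bar> \<le> 1) \<Longrightarrow>
       0 \<le> (\<Sum>i<v. p i * x i) \<longleftrightarrow> 0 \<le> (\<Sum>i<v. (if i < n then u i else - u (i - n)) * x i)"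
    using integer_weights[of v "\<lambda>i. if i < n then u i else - u (i - n)"] by blast
  define g where "g i zs = (if i < n then zs ! j ! i else zs ! l ! (i - n))" for i and zs :: "bool list list"
  have g: "comp1 F (g i) 0" if "i < v" for i
    using assms True that comp1_bit[of j i] comp1_bit[of l "i - n"]
    by (cases "i < n") (auto simp: g_def[abs_def] v_def)
  have "\<bar>0\<bar> + (\<Sum>i<v. \<bar>p i\<bar>) \<le> int v * 2 ^ (v * (v * v + v + 2))"
    using sum_bounded_above[of "{..<v}" "\<lambda>i. \<bar>p i\<bar>" "2 ^ (v * (v * v + v + 2))"] p(1) by simp
  also have "\<dots> < 2 ^ v * 2 ^ (v * (v * v + v + 2))"
    by (intro mult_strict_right_mono) (auto simp: of_nat_less_two_power)
  also have "\<dots> = 2 ^ (v * (v * v + v + 2) + v)"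
    by (simp add: power_add)
  finally have "comp1 F (\<lambda>zs. 0 \<le> 0 + (\<Sum>i<v. p i * of_bool (g i zs)))
    (v * 0 + (v + 1) * ((v * (v * v + v + 2) + v + 1) * 100) + 1)"
    by (intro comp1_int_threshold g)
  moreover have "0 \<le> 0 + (\<Sum>i<v. p i * of_bool (g i zs)) \<longleftrightarrow> sample_threshold n N u l zs (zs ! j)" for zs
  proof -
    have "0 \<le> (\<Sum>i<v. p i * of_bool (g i zs)) \<longleftrightarrow>
      0 \<le> (\<Sum>i<v. (if i < n then u i else - u (i - n)) * real_of_int (of_bool (g i zs)))"
      by (rule p(2)) auto
    also have "(\<Sum>i<v. (if i < n then u i else - u (i - n)) * real_of_int (of_bool (g i zs))) =
        linear_form n u (zs ! j) - linear_form n u (zs ! l)"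
      by (simp add: v_def sum_lessThan_double g_def linear_form_def sum_negf)
    finally show ?thesis
      using True by (simp add: sample_threshold_def)
  qed
  ultimately show ?thesis
    by (simp add: threshold_size_def Let_def v_def)
qed

text \<open>The product with \<open>fresh\<close> is made linear by two bits per sample: fresh and
  in agreement, with weight \<open>2 s\<close>, and fresh, with weight \<open>- (s + 1)\<close>. The
  absolute weights add up to \<open>N (3 s + 1)\<close>.\<close>

lemma comp1_fits: "comp1 F (fits n N s u l) (fits_size n N s)"
proof -
  define g where "g i zs = (if i < N then fresh n zs i \<and> sample_threshold n N u l zs (zs ! i) = zs ! i ! n
    else fresh n zs (i - N))" for i zs
  define p where "p i = (if i < N then 2 * int s else - (int s + 1))" for i
  have "comp1 F (g i) (agree_size n N)" if "i < 2 * N" for i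
  proof (cases "i < N")
    case True
    have "comp1 F (\<lambda>zs. fresh n zs i \<and> sample_threshold n N u l zs (zs ! i) = zs ! i ! n)
      (fresh_size n N + (2 * (threshold_size n + 0) + 5) + 1)"
      using True by (intro comp1_conj comp1_eq comp1_fresh comp1_sample_threshold comp1_bit) auto
    then show ?thesis
      using True by (simp add: g_def[abs_def] agree_size_def)
  next
    case False
    then have "comp1 F (\<lambda>zs. fresh n zs (i - N)) (agree_size n N)"
      using that by (intro comp1_mono[OF comp1_fresh]) (auto simp: agree_size_def)
    then show ?thesis
      using False by (simp add: g_def[abs_def])
  qed
  moreover have "\<bar>0\<bar> + (\<Sum>i<2 * N. \<bar>p i\<bar>) < 2 ^ (N * (3 * s + 1))"
  proof -
    have "\<bar>0\<bar> + (\<Sum>i<2 * N. \<bar>p i\<bar>) = int (N * (3 * s + 1))"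
      unfolding sum_lessThan_double by (simp add: p_def algebra_simps)
    also have "\<dots> < 2 ^ (N * (3 * s + 1))"
      by (rule of_nat_less_two_power)
    finally show ?thesis .
  qed
  ultimately have "comp1 F (\<lambda>zs. 0 \<le> 0 + (\<Sum>i<2 * N. p i * of_bool (g i zs)))
    (2 * N * agree_size n N + (2 * N + 1) * ((N * (3 * s + 1) + 1) * 100) + 1)"
    by (intro comp1_int_threshold)
  moreover have "0 \<le> 0 + (\<Sum>i<2 * N. p i * of_bool (g i zs)) \<longleftrightarrow> fits n N s u l zs" for zs
  proof -
    have "(\<Sum>i<2 * N. p i * of_bool (g i zs)) = (\<Sum>j<N. of_bool (fresh n zs j) *
     (2 * int s * of_bool (sample_threshold n N u l zs (zs ! j) = zs ! j ! n) - (int s + 1)))"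
      unfolding sum_lessThan_double sum.distrib[symmetric]
      by (intro sum.cong) (auto simp: p_def g_def)
    then show ?thesis
      by (simp add: fits_def)
  qed
  ultimately show ?thesis
    by (simp add: fits_size_def)
qed

lemma comp1_test: "comp1 F (sample_test n N q s u) (test_size n N q s)"
proof -
  have "comp1 F (\<lambda>zs. 0 \<le> - int q + (\<Sum>i<N. 1 * of_bool (fresh n zs i)))
    (N * fresh_size n N + (N + 1) * ((q + N + 1) * 100) + 1)"
  proof (rule comp1_int_threshold)
    have "\<bar>- int q\<bar> + (\<Sum>i<N. \<bar>1\<bar>) = int (q + N)"
      by simp
    also have "\<dots> < 2 ^ (q + N)"
      by (rule of_nat_less_two_power)
    finally show "\<bar>- int q\<bar> + (\<Sum>i<N. \<bar>1\<bar>) < 2 ^ (q + N)" .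
  qed (rule comp1_fresh)
  moreover have "comp1 F (\<lambda>zs. \<exists>g<s. \<exists>l<Suc N. fits n N s (u g) l zs)
    (s * ((Suc N * (fits_size n N s + 1) + 1) + 1) + 1)"
    by (intro comp1_Bex comp1_fits)
  ultimately have "comp1 F (\<lambda>zs. 0 \<le> - int q + (\<Sum>i<N. 1 * of_bool (fresh n zs i)) \<and>
      (\<exists>g<s. \<exists>l<Suc N. fits n N s (u g) l zs)) (test_size n N q s)"
    unfolding test_size_def by (rule comp1_conj)
  moreover have "(\<lambda>zs. 0 \<le> - int q + (\<Sum>i<N. 1 * of_bool (fresh n zs i)) \<and>
      (\<exists>g<s. \<exists>l<Suc N. fits n N s (u g) l zs)) = sample_test n N q s u"
    by (auto simp: sample_test_def fun_eq_iff)
  ultimately show ?thesis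
    by (simp only:)
qed

end

lemma test_circuit:
  obtains C where "length C \<le> N + test_size n N q s + 1"
    "\<And>D. (\<And>z. z \<in> set_pmf D \<Longrightarrow> length z = n + 1) \<Longrightarrow>
       run_circuit D C = map_pmf (sample_test n N q s u) (replicate_pmf N D)"
  using comp1_run_circuit[OF comp1_test[OF refl]] by blast


section \<open>The test in terms of the set of distinct sample points\<close>

lemma sum_first_occurrences:
  "(\<Sum>j<length xs. of_bool (xs ! j \<notin> set (take j xs)) * f (xs ! j)) = (\<Sum>x\<in>set xs. f x)"
  for f :: "'a \<Rightarrow> 'b::comm_semiring_1"
proof (induction xs rule: rev_induct)
  case (snoc x xs)
  have "(\<Sum>j<length xs. of_bool ((xs @ [x]) ! j \<notin> set (take j (xs @ [x]))) * f ((xs @ [x]) ! j)) =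
      (\<Sum>j<length xs. of_bool (xs ! j \<notin> set (take j xs)) * f (xs ! j))"
    by (intro sum.cong) (auto simp: nth_append)
  then show ?case
    using snoc by (cases "x \<in> set xs") (auto simp: insert_absorb add.commute)
qed simp

context
  fixes n N :: nat and xs :: "bool list list" and h :: "bool list \<Rightarrow> bool" and zs
  assumes xs: "length xs = N" "set xs \<subseteq> bitstrings n"
  defines "zs \<equiv> map (\<lambda>x. x @ [h x]) xs"
begin

lemma nth_labelled:
  assumes "j < N"
  shows "a < n \<Longrightarrow> zs ! j ! a = xs ! j ! a" "zs ! j ! n = h (xs ! j)"
    "linear_form n u (zs ! j) = linear_form n u (xs ! j)"
proof -
  have "length (xs ! j) = n"
    using assms xs nth_mem[of j xs] unfolding bitstrings_def by blast
  then show 1: "a < n \<Longrightarrow> zs ! j ! a = xs ! j ! a" "zs ! j ! n = h (xs ! j)" for a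
    using assms xs by (auto simp: zs_def nth_append)
  then show "linear_form n u (zs ! j) = linear_form n u (xs ! j)"
    by (auto simp: linear_form_def)
qed

lemma fresh_labelled:
  assumes "j < N"
  shows "fresh n zs j \<longleftrightarrow> xs ! j \<notin> set (take j xs)"
proof -
  have len: "length (xs ! l) = n" if "l < N" for l
    using that xs nth_mem[of l xs] unfolding bitstrings_def by blast
  have "(\<forall>a<n. zs ! l ! a = zs ! j ! a) \<longleftrightarrow> xs ! l = xs ! j" if "l < j" for l
  proof -
    have "l < N"
      using that assms by simp
    then show ?thesis
      using assms len[of l] len[of j] by (auto simp: nth_labelled intro!: nth_equalityI)
  qed
  then show ?thesis
    using assms xs(1) by (auto simp: fresh_def in_set_conv_nth)
qed

lemma fits_labelled:
  "fits n N s u l zs \<longleftrightarrow>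
     0 \<le> (\<Sum>x\<in>set xs. 2 * int s * of_bool (sample_threshold n N u l xs x = h x) - (int s + 1))"
proof -
  have "(\<Sum>j<N. of_bool (fresh n zs j) *
     (2 * int s * of_bool (sample_threshold n N u l zs (zs ! j) = zs ! j ! n) - (int s + 1))) =
     (\<Sum>j<length xs. of_bool (xs ! j \<notin> set (take j xs)) *
     (2 * int s * of_bool (sample_threshold n N u l xs (xs ! j) = h (xs ! j)) - (int s + 1)))"
    using xs(1) by (intro sum.cong)
      (auto simp: fresh_labelled nth_labelled(2) sample_threshold_def nth_labelled(3)[of l] nth_labelled(3))
  also have "\<dots> = (\<Sum>x\<in>set xs. 2 * int s * of_bool (sample_threshold n N u l xs x = h x) - (int s + 1))"
    by (rule sum_first_occurrences)
  finally show ?thesis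
    unfolding fits_def by (simp only:)
qed

lemma test_labelled:
  "sample_test n N q s u zs \<longleftrightarrow> q \<le> card (set xs) \<and> (\<exists>g<s. \<exists>l<Suc N.
     0 \<le> (\<Sum>x\<in>set xs. 2 * int s * of_bool (sample_threshold n N (u g) l xs x = h x) - (int s + 1)))"
proof -
  have "(\<Sum>j<N. of_bool (fresh n zs j)) =
     (\<Sum>j<length xs. of_bool (xs ! j \<notin> set (take j xs)) * (1::int))"
    using xs(1) by (intro sum.cong) (auto simp: fresh_labelled)
  also have "\<dots> = int (card (set xs))"
    using sum_first_occurrences[of xs "\<lambda>_. 1::int"] by simp
  finally show ?thesis
    unfolding sample_test_def fits_labelled by simp
qed

end


subsection \<open>Probability bounds\<close>

lemma finite_bitstrings: "finite (bitstrings n)"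
  unfolding bitstrings_def using finite_lists_length_eq[of "UNIV :: bool set" n] by simp

lemma bitstrings_nonempty: "bitstrings n \<noteq> {}"
  unfolding bitstrings_def using Ex_list_of_length by blast

lemma set_uniform_bits: "set_pmf (uniform_bits n) = bitstrings n"
  unfolding uniform_bits_def by (rule set_pmf_of_set[OF bitstrings_nonempty finite_bitstrings])

text \<open>The linear terms cancel in \<open>exp a \<le> 1 + a + a^2\<close> and
  \<open>exp (- a) \<le> 1 - a + a^2\<close>. The sharper exponent \<open>a^2 / 2\<close> would only
  improve constants.\<close>

lemma cosh_le_exp_square:
  fixes a :: real
  assumes "0 \<le> a" "a \<le> 1"
  shows "(exp a + exp (- a)) / 2 \<le> exp (a\<^sup>2)"
proof -
  have "1 + a + a\<^sup>2 / 2 \<le> exp a"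
    using assms(1) by (rule exp_lower_Taylor_quadratic)
  have pos: "0 \<le> 1 - a + a\<^sup>2"
    using assms by simp
  have "1 \<le> 1 + a\<^sup>2 / 2 + a ^ 3 / 2 + a ^ 4 / 2"
    using assms by simp
  also have "\<dots> = (1 - a + a\<^sup>2) * (1 + a + a\<^sup>2 / 2)"
    by (simp add: field_simps power2_eq_square power3_eq_cube power4_eq_xxxx)
  also have "\<dots> \<le> (1 - a + a\<^sup>2) * exp a"
    using pos \<open>1 + a + a\<^sup>2 / 2 \<le> exp a\<close> by (rule mult_left_mono[rotated])
  finally have "exp (- a) \<le> 1 - a + a\<^sup>2"
    by (simp add: exp_minus field_simps)
  moreover have "exp a \<le> 1 + a + a\<^sup>2"
    using assms by (rule exp_bound)
  moreover have "1 + a\<^sup>2 \<le> exp (a\<^sup>2)"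
    by (rule exp_ge_add_one_self)
  ultimately have "exp a + exp (- a) \<le> 2 * exp (a\<^sup>2)"
    by linarith
  then show ?thesis
    by simp
qed

text \<open>The values of a random function at distinct points are independent fair bits, so the
  expectation of the product factors.\<close>

lemma random_function_prod:
  fixes \<phi> :: "bool list \<Rightarrow> bool \<Rightarrow> real"
  assumes "X \<subseteq> bitstrings n" "\<And>x b. 0 \<le> \<phi> x b"
  shows "measure_pmf.expectation (random_function n) (\<lambda>\<psi>. \<Prod>x\<in>X. \<phi> x (\<psi> x)) =
    (\<Prod>x\<in>X. (\<phi> x True + \<phi> x False) / 2)"
proof -
  let ?A = "bitstrings n"
  have "PiE_dflt ?A undefined (\<lambda>_. UNIV :: bool set) = ?A \<rightarrow>\<^sub>E UNIV"
    by (auto simp: PiE_dflt_def PiE_def extensional_def)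
  then have rf: "random_function n = Pi_pmf ?A undefined (\<lambda>_. pmf_of_set (UNIV :: bool set))"
    unfolding random_function_def by (subst Pi_pmf_of_set) (auto simp: finite_bitstrings)
  \<comment> \<open>Padding with factors 1 lets the product run over the whole domain, where the
    product distribution lives.\<close>
  define \<phi>' where "\<phi>' x b = (if x \<in> X then \<phi> x b else 1)" for x b
  have prod: "(\<Prod>x\<in>X. \<phi> x (\<psi> x)) = (\<Prod>x\<in>?A. \<phi>' x (\<psi> x))" for \<psi>
    using assms(1) finite_bitstrings by (intro prod.mono_neutral_cong_left) (auto simp: \<phi>'_def)
  have "measure_pmf.expectation (random_function n) (\<lambda>\<psi>. \<Prod>x\<in>X. \<phi> x (\<psi> x)) =
     (\<Prod>x\<in>?A. measure_pmf.expectation (pmf_of_set (UNIV :: bool set)) (\<phi>' x))"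
    unfolding rf prod
    by (rule expectation_prod_Pi_pmf)
       (auto simp: finite_bitstrings \<phi>'_def assms(2) intro!: integrable_measure_pmf_finite)
  also have "\<dots> = (\<Prod>x\<in>?A. (\<phi>' x True + \<phi>' x False) / 2)"
    by (simp add: integral_pmf_of_set UNIV_bool add.commute)
  also have "\<dots> = (\<Prod>x\<in>X. (\<phi> x True + \<phi> x False) / 2)"
    using assms(1) finite_bitstrings by (intro prod.mono_neutral_cong_right) (auto simp: \<phi>'_def)
  finally show ?thesis .
qed

lemma finite_random_function: "finite (set_pmf (random_function n))"
proof -
  have "finite (bitstrings n \<rightarrow>\<^sub>E (UNIV :: bool set))"
    by (intro finite_PiE finite_bitstrings) auto
  then show ?thesis
    unfolding random_function_def by (subst set_pmf_of_set) (auto simp: PiE_eq_empty_iff)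
qed

text \<open>A Chernoff bound. The exponential moment of the score is a product over the points, with
  each factor at most \<open>exp (- 1 / (4 s^2))\<close>.\<close>

lemma random_function_agreement:
  assumes X: "X \<subseteq> bitstrings n" and s: "1 \<le> s"
  shows "measure_pmf.prob (random_function n)
     {\<psi>. 0 \<le> (\<Sum>x\<in>X. 2 * int s * of_bool (H x = \<psi> x) - (int s + 1))} \<le> exp (- real (card X) / (4 * (real s)\<^sup>2))"
proof -
  \<comment> \<open>A factor is at most \<open>exp (- \<mu> + (\<mu> s)^2)\<close>, and this
    \<open>\<mu>\<close> minimises the exponent.\<close>
  define \<mu> where "\<mu> = 1 / (2 * (real s)\<^sup>2)"
  define \<phi> where "\<phi> x b = exp (\<mu> * (2 * real s * of_bool (H x = b) - (real s + 1)))" for x b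
  let ?S = "\<lambda>\<psi>. \<Sum>x\<in>X. 2 * int s * of_bool (H x = \<psi> x) - (int s + 1)"
  have fin: "finite X"
    using X finite_bitstrings finite_subset by blast
  have prod: "(\<Prod>x\<in>X. \<phi> x (\<psi> x)) = exp (\<mu> * real_of_int (?S \<psi>))" for \<psi>
    using fin by (simp add: \<phi>_def exp_sum[symmetric] sum_distrib_left)
  have "measure_pmf.prob (random_function n) {\<psi>. 0 \<le> ?S \<psi>} =
     measure_pmf.expectation (random_function n) (indicator {\<psi>. 0 \<le> ?S \<psi>})"
    by simp
  \<comment> \<open>Markov's inequality: the exponential is at least 1 where the score is
    nonnegative and positive elsewhere.\<close>
  also have "\<dots> \<le> measure_pmf.expectation (random_function n) (\<lambda>\<psi>. \<Prod>x\<in>X. \<phi> x (\<psi> x))"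
  proof (intro integral_mono integrable_measure_pmf_finite finite_random_function)
    fix \<psi>
    show "indicator {\<psi>. 0 \<le> ?S \<psi>} \<psi> \<le> (\<Prod>x\<in>X. \<phi> x (\<psi> x))"
    proof (cases "0 \<le> ?S \<psi>")
      case True
      then have "0 \<le> \<mu> * real_of_int (?S \<psi>)"
        by (intro mult_nonneg_nonneg) (simp_all only: of_int_0_le_iff \<mu>_def zero_le_divide_1_iff, simp)
      then show ?thesis
        unfolding prod by (simp only: indicator_def one_le_exp_iff split: if_splits) simp
    qed (simp add: prod)
  qed
  also have "\<dots> = (\<Prod>x\<in>X. (\<phi> x True + \<phi> x False) / 2)"
    by (rule random_function_prod[OF X]) (simp add: \<phi>_def)
  also have "\<dots> \<le> (\<Prod>x\<in>X. exp (- 1 / (4 * (real s)\<^sup>2)))"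
  proof (rule prod_mono)
    fix x assume "x \<in> X"
    define a where "a = 1 / (2 * real s)"
    have "\<mu> * (2 * real s - (real s + 1)) = a - \<mu>" "\<mu> * (- (real s + 1)) = - a - \<mu>"
      using s by (simp_all add: \<mu>_def a_def power2_eq_square field_simps)
    then have "(\<phi> x True + \<phi> x False) / 2 = exp (- \<mu>) * ((exp a + exp (- a)) / 2)"
      by (cases "H x") (simp_all add: \<phi>_def exp_diff exp_minus field_simps)
    also have "\<dots> \<le> exp (- \<mu>) * exp (a\<^sup>2)"
      using s by (intro mult_left_mono cosh_le_exp_square) (auto simp: a_def field_simps)
    also have "\<dots> = exp (- 1 / (4 * (real s)\<^sup>2))"
      using s by (simp add: exp_add[symmetric] \<mu>_def a_def power2_eq_square field_simps)
    finally show "0 \<le> (\<phi> x True + \<phi> x False) / 2 \<and> (\<phi> x True + \<phi> x False) / 2 \<le> exp (- 1 / (4 * (real s)\<^sup>2))"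
      by (simp add: \<phi>_def add_nonneg_nonneg)
  qed
  also have "\<dots> = exp (- real (card X) / (4 * (real s)\<^sup>2))"
    by (simp add: exp_of_nat_mult[symmetric])
  finally show ?thesis .
qed

text \<open>
  While fewer than \<open>q\<close> points have been seen, each sample is new with probability at least \<open>\<delta>\<close>, so
  the expected number of distinct points seen bounds \<open>\<delta>\<close> times the expected time spent below \<open>q\<close>.
\<close>

lemma replicate_pmf_few_distinct:
  assumes \<delta>: "0 \<le> \<delta>" "\<And>A. finite A \<Longrightarrow> card A < q \<Longrightarrow> \<delta> \<le> measure_pmf.prob D (- A)"
    and "finite A" "card A \<le> q"
  shows "real N * \<delta> * pmf (map_pmf (\<lambda>xs. card (A \<union> set xs) < q) (replicate_pmf N D)) True \<le> real q - real (card A)"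
  using assms(3,4)
proof (induction N arbitrary: A)
  case 0
  then show ?case by simp
next
  case (Suc N)
  define p where "p N A = pmf (map_pmf (\<lambda>xs. card (A \<union> set xs) < q) (replicate_pmf N D)) True" for N A
  have p_le: "p N A \<le> 1" for N A
    by (simp add: p_def pmf_le_1)
  have p_nonneg: "0 \<le> p N A" for N A
    by (simp add: p_def)
  show ?case
  proof (cases "card A < q")
    case False
    have "p (Suc N) A = 0"
    proof -
      have "card A \<le> card (A \<union> set xs)" for xs
        using Suc.prems by (intro card_mono) auto
      then have "\<not> card (A \<union> set xs) < q" for xs
        using False by (meson le_less_trans)
      then show ?thesis
        by (simp add: p_def map_pmf_const)
    qed
    then show ?thesis
      using Suc.prems by (simp add: p_def)
  next
    case True
    have p_Suc: "p (Suc N) A = measure_pmf.expectation D (\<lambda>x. p N (insert x A))"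
      by (simp add: p_def map_bind_pmf pmf_bind map_pmf_def[symmetric] bind_return_pmf)
        (simp add: map_pmf_def bind_assoc_pmf bind_return_pmf)
    have int: "integrable D (\<lambda>x. p N (insert x A))"
      by (rule measure_pmf.integrable_const_bound[of _ 1]) (auto simp: p_le p_nonneg)
    have "real N * \<delta> * p (Suc N) A = measure_pmf.expectation D (\<lambda>x. real N * \<delta> * p N (insert x A))"
      by (simp add: p_Suc)
    \<comment> \<open>Condition on the first sample \<open>x\<close>. The induction hypothesis for
      \<open>insert x A\<close> gains 1 exactly when \<open>x\<close> is new.\<close>
    also have "\<dots> \<le> measure_pmf.expectation D (\<lambda>x. (real q - real (card A)) - indicator (- A) x)"
    proof (rule integral_mono)
      fix x
      show "real N * \<delta> * p N (insert x A) \<le> real q - real (card A) - indicator (- A) x"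
        using Suc.IH[of "insert x A"] Suc.prems True unfolding p_def
        by (cases "x \<in> A") (auto simp: insert_absorb)
    qed (use int in \<open>auto intro!: measure_pmf.integrable_const_bound[of _ "1"] Bochner_Integration.integrable_diff simp: indicator_def\<close>)
    also have "\<dots> = real q - real (card A) - measure_pmf.prob D (- A)"
      by (subst Bochner_Integration.integral_diff)
        (auto intro!: measure_pmf.integrable_const_bound[of _ "1"])
    also have "\<dots> \<le> real q - real (card A) - \<delta>"
      using \<delta>(2)[OF Suc.prems(1) True] by simp
    finally have "real N * \<delta> * p (Suc N) A + \<delta> \<le> real q - real (card A)"
      by simp
    \<comment> \<open>The gain \<open>\<delta>\<close> from the first sample pays for the additional
      summand when \<open>N\<close> becomes \<open>Suc N\<close>.\<close>
    moreover have "\<delta> * p (Suc N) A \<le> \<delta>"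
      using \<delta>(1) p_le[of "Suc N" A] by (simp add: mult_left_le)
    ultimately show ?thesis
      unfolding p_def[symmetric] by (simp add: algebra_simps)
  qed
qed


subsection \<open>The distinguisher\<close>

text \<open>An odd number of gates excludes ties, so that every point has a strict majority of agreeing gates.\<close>

lemma maj_thr_odd: "maj_thr (G @ G @ [(\<lambda>_. 0, 0)]) z \<longleftrightarrow> maj_thr G z"
  \<comment> \<open>The added gate compares 0 with 0 and is always true. Doubling the others turns a
    tie into a majority for 1 and preserves every strict majority.\<close>
  by (auto simp: maj_thr_def thr_def)

lemma maj_thr_agreement:
  assumes "odd (length G)"
  shows "length G + 1 \<le> 2 * card {g. g < length G \<and> thr (G ! g) z = maj_thr G z}"
proof -
  define T where "T = {g. g < length G \<and> thr (G ! g) z}"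
  have T: "length (filter (\<lambda>g. thr g z) G) = card T"
    by (simp add: T_def length_filter_conv_card)
  show ?thesis
  proof (cases "maj_thr G z")
    case True
    then have "length G \<le> 2 * card T"
      by (simp add: maj_thr_def T)
    moreover have "length G \<noteq> 2 * card T"
      using assms by auto
    ultimately show ?thesis
      using True by (simp add: T_def)
  next
    case False
    then have "2 * card T < length G"
      by (simp add: maj_thr_def T)
    moreover have "{g. g < length G \<and> thr (G ! g) z = maj_thr G z} = {..<length G} - T"
      using False by (auto simp: T_def)
    then have "card {g. g < length G \<and> thr (G ! g) z = maj_thr G z} = length G - card T"
      using card_Diff_subset[of T "{..<length G}"] finite_subset[of T "{..<length G}"]
      by (auto simp: T_def)
    ultimately show ?thesis
      by simp
  qed
qed

text \<open>On the sample, a threshold \<open>\<theta>\<close> acts like the least sampled value that is at least \<open>\<theta>\<close>.\<close>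

lemma threshold_at_sample:
  assumes "length xs = N"
  shows "\<exists>l<Suc N. \<forall>x\<in>set xs. sample_threshold n N u l xs x \<longleftrightarrow> \<theta> \<le> linear_form n u x"
proof (cases "\<exists>j<N. \<theta> \<le> linear_form n u (xs ! j)")
  case False
  then show ?thesis
    using assms by (intro exI[of _ N]) (auto simp: sample_threshold_def in_set_conv_nth)
next
  case True
  define Y where "Y = {j. j < N \<and> \<theta> \<le> linear_form n u (xs ! j)}"
  have "finite Y" "Y \<noteq> {}"
    using True by (auto simp: Y_def)
  then obtain l where l: "l \<in> Y" "\<And>j. j \<in> Y \<Longrightarrow> linear_form n u (xs ! l) \<le> linear_form n u (xs ! j)"
    using arg_min_if_finite[of Y "\<lambda>j. linear_form n u (xs ! j)"] by (meson not_le)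
  have "sample_threshold n N u l xs (xs ! j) \<longleftrightarrow> \<theta> \<le> linear_form n u (xs ! j)" if "j < N" for j
    using l that by (fastforce simp: Y_def sample_threshold_def)
  then show ?thesis
    using l(1) assms by (intro exI[of _ l]) (auto simp: Y_def in_set_conv_nth)
qed

lemma sum_append_split:
  fixes w :: "nat \<Rightarrow> real"
  shows "(\<Sum>i<length (k @ x). w i * of_bool ((k @ x) ! i)) =
    (\<Sum>i<length k. w i * of_bool (k ! i)) + linear_form (length x) (\<lambda>a. w (length k + a)) x"
proof -
  have "(\<Sum>i<length k + length x. w i * of_bool ((k @ x) ! i)) =
      (\<Sum>i<length k. w i * of_bool ((k @ x) ! i)) + (\<Sum>a<length x. w (length k + a) * of_bool ((k @ x) ! (length k + a)))"
    using sum.atLeastLessThan_concat[of 0 "length k" "length k + length x" "\<lambda>i. w i * of_bool ((k @ x) ! i)"]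
      sum.shift_bounds_nat_ivl[of "\<lambda>i. w i * of_bool ((k @ x) ! i)" 0 "length k" "length x"]
    by (simp add: lessThan_atLeast0 add.commute)
  then show ?thesis
    by (simp add: nth_append linear_form_def)
qed

text \<open>Averaging over the gates: at every point at least \<open>(s + 1) / 2\<close> gates agree
  with the majority, so the scores of all gates add up to a nonnegative number and one of them is
  nonnegative. The weights \<open>fst (G ! g) (\<kappa> + a)\<close> do not involve the key.\<close>

lemma maj_thr_fits_sample:
  assumes G: "odd (length G)" and k: "k \<in> bitstrings \<kappa>"
    and xs: "length xs = N" "set xs \<subseteq> bitstrings n"
    and h: "\<And>x. x \<in> set xs \<Longrightarrow> h x = maj_thr G (k @ x)"
  shows "\<exists>g<length G. \<exists>l<Suc N. 0 \<le> (\<Sum>x\<in>set xs. 2 * int (length G) *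
     of_bool (sample_threshold n N (\<lambda>a. fst (G ! g) (\<kappa> + a)) l xs x = h x) - (int (length G) + 1))"
proof -
  define s where "s = length G"
  define u where "u g a = fst (G ! g) (\<kappa> + a)" for g a
  have "\<exists>l<Suc N. \<forall>x\<in>set xs. sample_threshold n N (u g) l xs x \<longleftrightarrow> thr (G ! g) (k @ x)" for g
  proof -
    \<comment> \<open>For a fixed key, the key bits contribute a constant, which is moved into the
      threshold.\<close>
    have "thr (G ! g) (k @ x) \<longleftrightarrow>
      snd (G ! g) - (\<Sum>i<length k. fst (G ! g) i * of_bool (k ! i)) \<le> linear_form n (u g) x" if "x \<in> set xs" for x
    proof -
      have "length x = n" "length k = \<kappa>"
        using that xs(2) k by (auto simp: bitstrings_def)
      then show ?thesis
        unfolding thr_def sum_append_split by (auto simp: u_def[abs_def])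
    qed
    then show ?thesis
      using threshold_at_sample[OF xs(1), of n "u g"
          "snd (G ! g) - (\<Sum>i<length k. fst (G ! g) i * of_bool (k ! i))"] by simp
  qed
  then obtain l where l: "\<And>g. l g < Suc N"
    "\<And>g x. x \<in> set xs \<Longrightarrow> sample_threshold n N (u g) (l g) xs x \<longleftrightarrow> thr (G ! g) (k @ x)"
    by metis
  define \<sigma> where "\<sigma> g = (\<Sum>x\<in>set xs. 2 * int s * of_bool (sample_threshold n N (u g) (l g) xs x = h x) - (int s + 1))" for g
  have "(\<Sum>g<s. \<sigma> g) = (\<Sum>x\<in>set xs. \<Sum>g<s. 2 * int s * of_bool (thr (G ! g) (k @ x) = maj_thr G (k @ x)) - (int s + 1))"
    unfolding \<sigma>_def by (subst sum.swap) (intro sum.cong refl, simp add: l(2) h)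
  also have "\<dots> \<ge> 0"
  proof (rule sum_nonneg)
    fix x
    define c where "c = card {g. g < s \<and> thr (G ! g) (k @ x) = maj_thr G (k @ x)}"
    have "s + 1 \<le> 2 * c"
      using maj_thr_agreement[OF G, of "k @ x"] by (simp add: c_def s_def)
    have "{..<s} \<inter> {g. thr (G ! g) (k @ x) = maj_thr G (k @ x)} = {g. g < s \<and> thr (G ! g) (k @ x) = maj_thr G (k @ x)}"
      by auto
    then have "(\<Sum>g<s. 2 * int s * of_bool (thr (G ! g) (k @ x) = maj_thr G (k @ x)) - (int s + 1)) =
       2 * int s * int c - int s * (int s + 1)"
      by (simp add: sum_subtractf sum_distrib_left[symmetric] c_def)
    also have "\<dots> = int s * (2 * int c - (int s + 1))"
      by (simp add: algebra_simps)
    also have "\<dots> \<ge> 0"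
      using \<open>s + 1 \<le> 2 * c\<close> by (intro mult_nonneg_nonneg) auto
    finally show "0 \<le> (\<Sum>g<s. 2 * int s * of_bool (thr (G ! g) (k @ x) = maj_thr G (k @ x)) - (int s + 1))" .
  qed
  finally have "0 \<le> (\<Sum>g<s. \<sigma> g)" .
  moreover have "0 < s"
    using G by (auto simp: s_def intro: odd_pos)
  ultimately obtain g where "g < s" "0 \<le> \<sigma> g"
    using sum_strict_mono[of "{..<s}" \<sigma> "\<lambda>_. 0"] by (metis finite_lessThan lessThan_iff emptyE not_le sum.neutral_const less_irrefl)
  then show ?thesis
    using l(1) unfolding \<sigma>_def s_def u_def by blast
qed

lemma replicate_pmf_map: "replicate_pmf N (map_pmf g D) = map_pmf (map g) (replicate_pmf N D)"
  by (induction N) (simp_all add: map_pmf_def bind_assoc_pmf bind_return_pmf)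

text \<open>The sample points are fixed before \<open>\<psi>\<close> is drawn, and the hypotheses
  depend on the points but not on the labels. Hence a union bound over \<open>s (N + 1)\<close>
  fixed hypotheses applies.\<close>

lemma prob_test_random_function:
  assumes xs: "length xs = N" "set xs \<subseteq> bitstrings n" and s: "1 \<le> s"
    and small: "real s * real (Suc N) * exp (- real q / (4 * (real s)\<^sup>2)) \<le> 1 / 4"
  shows "measure_pmf.prob (random_function n) {\<psi>. sample_test n N q s u (map (\<lambda>x. x @ [\<psi> x]) xs)} \<le> 1 / 4"
proof (cases "q \<le> card (set xs)")
  case False
  then show ?thesis
    by (simp add: test_labelled[OF xs])
next
  case True
  let ?B = "\<lambda>(g, l). {\<psi>. 0 \<le> (\<Sum>x\<in>set xs. 2 * int s * of_bool (sample_threshold n N (u g) l xs x = \<psi> x) - (int s + 1))}"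
  have "{\<psi>. sample_test n N q s u (map (\<lambda>x. x @ [\<psi> x]) xs)} \<subseteq> (\<Union>p\<in>{..<s} \<times> {..<Suc N}. ?B p)"
    by (auto simp: test_labelled[OF xs])
  then have "measure_pmf.prob (random_function n) {\<psi>. sample_test n N q s u (map (\<lambda>x. x @ [\<psi> x]) xs)}
     \<le> measure_pmf.prob (random_function n) (\<Union>p\<in>{..<s} \<times> {..<Suc N}. ?B p)"
    by (intro measure_pmf.finite_measure_mono) auto
  also have "\<dots> \<le> (\<Sum>p\<in>{..<s} \<times> {..<Suc N}. measure_pmf.prob (random_function n) (?B p))"
    by (intro measure_pmf.finite_measure_subadditive_finite) auto
  also have "\<dots> \<le> (\<Sum>p\<in>{..<s} \<times> {..<Suc N}. exp (- real q / (4 * (real s)\<^sup>2)))"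
  proof (rule sum_mono)
    fix p
    have "exp (- real (card (set xs)) / (4 * (real s)\<^sup>2)) \<le> exp (- real q / (4 * (real s)\<^sup>2))"
      using True by (simp add: divide_right_mono)
    then show "measure_pmf.prob (random_function n) (?B p) \<le> exp (- real q / (4 * (real s)\<^sup>2))"
      using order_trans[OF random_function_agreement[OF xs(2) s]] by (cases p) simp
  qed
  also have "\<dots> = real s * real (Suc N) * exp (- real q / (4 * (real s)\<^sup>2))"
    by (simp add: algebra_simps)
  finally show ?thesis
    using small by linarith
qed

text \<open>The circuit performs \<open>sample_test\<close>. For every key it accepts whenever
  \<open>q\<close> distinct points occur, thus with probability at least 1/2; for a random function
  it accepts with probability at most 1/4.\<close>

lemma distinguisher:
  fixes E :: "bool list pmf" and K :: "bool list pmf"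
  assumes E: "set_pmf E \<subseteq> bitstrings n"
    and K: "set_pmf K \<subseteq> bitstrings \<kappa>"
    and G: "odd (length G)" "\<And>k x. k \<in> bitstrings \<kappa> \<Longrightarrow> x \<in> bitstrings n \<Longrightarrow> f k x = maj_thr G (k @ x)"
    and \<delta>: "0 \<le> \<delta>" "\<And>A. finite A \<Longrightarrow> card A < q \<Longrightarrow> \<delta> \<le> measure_pmf.prob E (- A)"
    and N: "2 * real q \<le> real N * \<delta>" "0 < q"
    and small: "real (length G) * real (Suc N) * exp (- real q / (4 * (real (length G))\<^sup>2)) \<le> 1 / 4"
  obtains C where "length C \<le> N + test_size n N q (length G) + 1"
    "1 / 4 \<le> \<bar>pmf (bind_pmf K (\<lambda>k. run_circuit (map_pmf (\<lambda>x. x @ [f k x]) E) C)) True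
       - pmf (bind_pmf (random_function n) (\<lambda>\<psi>. run_circuit (map_pmf (\<lambda>x. x @ [\<psi> x]) E) C)) True\<bar>"
proof -
  define s where "s = length G"
  have s: "1 \<le> s"
    using G(1) by (auto simp: s_def intro: odd_pos Suc_leI)
  define u where "u g a = fst (G ! g) (\<kappa> + a)" for g a
  obtain C where C: "length C \<le> N + test_size n N q s + 1"
    "\<And>D. (\<And>z. z \<in> set_pmf D \<Longrightarrow> length z = n + 1) \<Longrightarrow>
       run_circuit D C = map_pmf (sample_test n N q s u) (replicate_pmf N D)"
    using test_circuit[of N n q s u] by blast
  define R where "R = replicate_pmf N E"
  have R: "length xs = N" "set xs \<subseteq> bitstrings n" if "xs \<in> set_pmf R" for xs
    using that E by (auto simp: R_def set_replicate_pmf)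
  have run: "run_circuit (map_pmf (\<lambda>x. x @ [h x]) E) C = map_pmf (\<lambda>xs. sample_test n N q s u (map (\<lambda>x. x @ [h x]) xs)) R" for h
  proof -
    have "run_circuit (map_pmf (\<lambda>x. x @ [h x]) E) C = map_pmf (sample_test n N q s u) (replicate_pmf N (map_pmf (\<lambda>x. x @ [h x]) E))"
      using E by (intro C(2)) (auto simp: bitstrings_def)
    then show ?thesis
      by (simp add: replicate_pmf_map R_def pmf.map_comp o_def)
  qed
  have few: "pmf (map_pmf (\<lambda>xs. card (set xs) < q) R) True \<le> 1 / 2"
  proof -
    have "real N * \<delta> * pmf (map_pmf (\<lambda>xs. card (set xs) < q) R) True \<le> real q"
      using replicate_pmf_few_distinct[OF \<delta>, where A = "{}" and N = N] by (simp add: R_def)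
    moreover have "2 * real q * pmf (map_pmf (\<lambda>xs. card (set xs) < q) R) True
        \<le> real N * \<delta> * pmf (map_pmf (\<lambda>xs. card (set xs) < q) R) True"
      using N(1) by (intro mult_right_mono) auto
    ultimately have "real q * (2 * pmf (map_pmf (\<lambda>xs. card (set xs) < q) R) True) \<le> real q * 1"
      by (simp add: algebra_simps)
    then show ?thesis
      using N(2) by (simp add: mult_le_cancel_left)
  qed
  have many: "1 / 2 \<le> pmf (run_circuit (map_pmf (\<lambda>x. x @ [f k x]) E) C) True" if "k \<in> set_pmf K" for k
  proof -
    have k: "k \<in> bitstrings \<kappa>"
      using that K by blast
    have "sample_test n N q s u (map (\<lambda>x. x @ [f k x]) xs)" if "xs \<in> set_pmf R" "q \<le> card (set xs)" for xs
    proof -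
      have "\<And>x. x \<in> set xs \<Longrightarrow> f k x = maj_thr G (k @ x)"
        using G(2) k R(2)[OF that(1)] by blast
      from maj_thr_fits_sample[OF G(1) k R[OF that(1)] this] show ?thesis
        using that(2) unfolding test_labelled[OF R[OF that(1)]] s_def u_def by blast
    qed
    then have "measure_pmf.prob R {xs. \<not> sample_test n N q s u (map (\<lambda>x. x @ [f k x]) xs)} \<le> measure_pmf.prob R {xs. card (set xs) < q}"
      by (intro measure_pmf.finite_measure_mono_AE) (auto simp: AE_measure_pmf_iff not_le[symmetric])
    also have "\<dots> \<le> 1 / 2"
      using few by (simp add: pmf_map vimage_def)
    finally have "1 / 2 \<le> 1 - measure_pmf.prob R {xs. \<not> sample_test n N q s u (map (\<lambda>x. x @ [f k x]) xs)}"
      by simp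
    also have "\<dots> = measure_pmf.prob R {xs. sample_test n N q s u (map (\<lambda>x. x @ [f k x]) xs)}"
      using measure_pmf.prob_compl[of "{xs. \<not> sample_test n N q s u (map (\<lambda>x. x @ [f k x]) xs)}" R]
      by (simp add: Compl_eq_Diff_UNIV[symmetric] Collect_neg_eq[symmetric])
    finally show ?thesis
      by (simp add: run pmf_map vimage_def)
  qed
  have "1 / 2 \<le> pmf (bind_pmf K (\<lambda>k. run_circuit (map_pmf (\<lambda>x. x @ [f k x]) E) C)) True"
    unfolding pmf_bind using many
    by (intro measure_pmf.integral_ge_const measure_pmf.integrable_const_bound[of _ 1])
       (auto simp: AE_measure_pmf_iff pmf_le_1)
  moreover have "pmf (bind_pmf (random_function n) (\<lambda>\<psi>. run_circuit (map_pmf (\<lambda>x. x @ [\<psi> x]) E) C)) True \<le> 1 / 4"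
  proof -
    \<comment> \<open>The order of the two independent choices is exchanged so that the sample
      points are drawn first.\<close>
    have "bind_pmf (random_function n) (\<lambda>\<psi>. run_circuit (map_pmf (\<lambda>x. x @ [\<psi> x]) E) C) =
      bind_pmf R (\<lambda>xs. map_pmf (\<lambda>\<psi>. sample_test n N q s u (map (\<lambda>x. x @ [\<psi> x]) xs)) (random_function n))"
      unfolding run unfolding map_pmf_def by (rule bind_commute_pmf)
    moreover have "pmf (map_pmf (\<lambda>\<psi>. sample_test n N q s u (map (\<lambda>x. x @ [\<psi> x]) xs)) (random_function n)) True \<le> 1 / 4"
      if "xs \<in> set_pmf R" for xs
      using prob_test_random_function[OF R[OF that] s small[folded s_def], of u] by (simp add: pmf_map vimage_def)
    ultimately show ?thesis
      by (simp only: pmf_bind)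
         (intro measure_pmf.integral_le_const measure_pmf.integrable_const_bound[of _ 1],
           auto simp: AE_measure_pmf_iff pmf_le_1)
  qed
  ultimately show thesis
    using C(1) by (intro that[of C]) (auto simp: s_def)
qed


subsection \<open>Polynomial bounds\<close>

lemma poly_bounded_poly: "poly_bounded (poly p)"
  unfolding poly_bounded_def by blast

lemma poly_bounded_const: "poly_bounded (\<lambda>_. c)"
  unfolding poly_bounded_def by (intro exI[of _ "[:c:]"]) simp

lemma poly_bounded_id: "poly_bounded (\<lambda>\<eta>. \<eta>)"
  unfolding poly_bounded_def by (intro exI[of _ "[:0, 1:]"]) simp

lemma poly_bounded_add: "poly_bounded g \<Longrightarrow> poly_bounded h \<Longrightarrow> poly_bounded (\<lambda>\<eta>. g \<eta> + h \<eta>)"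
  unfolding poly_bounded_def by (metis add_mono poly_add)

lemma poly_bounded_mult: "poly_bounded g \<Longrightarrow> poly_bounded h \<Longrightarrow> poly_bounded (\<lambda>\<eta>. g \<eta> * h \<eta>)"
  unfolding poly_bounded_def by (metis mult_le_mono poly_mult)

lemma poly_bounded_Suc: "poly_bounded g \<Longrightarrow> poly_bounded (\<lambda>\<eta>. Suc (g \<eta>))"
  using poly_bounded_add[OF _ poly_bounded_const[of 1]] by simp

lemma poly_bounded_power: "poly_bounded g \<Longrightarrow> poly_bounded (\<lambda>\<eta>. g \<eta> ^ k)"
  by (induction k) (auto intro: poly_bounded_const poly_bounded_mult)

lemma poly_bounded_mono: "poly_bounded h \<Longrightarrow> (\<And>\<eta>. g \<eta> \<le> h \<eta>) \<Longrightarrow> poly_bounded g"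
  unfolding poly_bounded_def by (meson le_trans)

lemmas poly_bounded_intros = poly_bounded_const poly_bounded_id poly_bounded_poly poly_bounded_add
  poly_bounded_mult poly_bounded_Suc poly_bounded_power

lemma poly_bounded_test_size:
  assumes "poly_bounded n" "poly_bounded N" "poly_bounded q" "poly_bounded s"
  shows "poly_bounded (\<lambda>\<eta>. test_size (n \<eta>) (N \<eta>) (q \<eta>) (s \<eta>))"
  unfolding test_size_def fits_size_def agree_size_def threshold_size_def fresh_size_def Let_def
  by (intro poly_bounded_intros assms)

lemma poly_bounded_times_exp_tendsto:
  assumes "poly_bounded g"
  shows "(\<lambda>\<eta>. real (g \<eta>) * exp (- real \<eta>)) \<longlonglongrightarrow> 0"
proof -
  obtain p :: "nat poly" where p: "\<And>\<eta>. g \<eta> \<le> poly p \<eta>"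
    using assms unfolding poly_bounded_def by blast
  have "(\<lambda>\<eta>. \<Sum>i\<le>degree p. real (coeff p i) * (real \<eta> ^ i / exp (real \<eta>))) \<longlonglongrightarrow> (\<Sum>i\<le>degree p. real (coeff p i) * 0)"
    by (intro tendsto_intros filterlim_compose[OF tendsto_power_div_exp_0 filterlim_real_sequentially])
  moreover have "(\<Sum>i\<le>degree p. real (coeff p i) * (real \<eta> ^ i / exp (real \<eta>))) = real (poly p \<eta>) * exp (- real \<eta>)" for \<eta>
    by (simp add: poly_altdef exp_minus sum_distrib_right divide_inverse mult.assoc)
  ultimately have "(\<lambda>\<eta>. real (poly p \<eta>) * exp (- real \<eta>)) \<longlonglongrightarrow> 0"
    by simp
  then show ?thesis
    by (rule tendsto_sandwich[OF _ _ tendsto_const, rotated 2])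
      (auto intro!: always_eventually mult_right_mono simp: p)
qed

section \<open>Choice of the parameters and the asymptotic conclusion\<close>

theorem theorem1p8:
  fixes n \<kappa> m \<rho> :: "nat \<Rightarrow> nat"
    and gen enc :: "nat \<Rightarrow> bool list \<Rightarrow> bool list"
    and f :: "nat \<Rightarrow> bool list \<Rightarrow> bool list \<Rightarrow> bool"
  assumes "poly_bounded n" and "poly_bounded \<kappa>" and "poly_bounded m" and "poly_bounded \<rho>"
    and "\<And>\<eta> c. c \<in> bitstrings (\<rho> \<eta>) \<Longrightarrow> gen \<eta> c \<in> bitstrings (\<kappa> \<eta>)"
    and "\<And>\<eta> r. r \<in> bitstrings (m (n \<eta>)) \<Longrightarrow> enc \<eta> r \<in> bitstrings (n \<eta>)"
    and "polynomial_time (\<lambda>\<eta>. {[c] | c. c \<in> bitstrings (\<rho> \<eta>)}) (\<lambda>\<eta> xss. gen \<eta> (xss ! 0))"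
    and "polynomial_time (\<lambda>\<eta>. {[r] | r. r \<in> bitstrings (m (n \<eta>))}) (\<lambda>\<eta> xss. enc \<eta> (xss ! 0))"
    and "polynomial_time (\<lambda>\<eta>. {[k, x] | k x. k \<in> bitstrings (\<kappa> \<eta>) \<and> x \<in> bitstrings (n \<eta>)})
           (\<lambda>\<eta> xss. [f \<eta> (xss ! 0) (xss ! 1)])"
    and "evaluated_by_maj_thr \<kappa> n f"
    and "\<not> poly_concentrated (\<lambda>\<eta>. encoded_input (m (n \<eta>)) (enc \<eta>))"
  shows "\<exists>t :: nat poly. \<forall>\<epsilon>. negligible_fun \<epsilon> \<longrightarrow>
           \<not> encoded_input_weak_prf (poly t) \<epsilon> n (\<lambda>\<eta>. m (n \<eta>)) f
               (\<lambda>\<eta>. map_pmf (gen \<eta>) (uniform_bits (\<rho> \<eta>))) enc"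
proof -
  define E where "E \<eta> = encoded_input (m (n \<eta>)) (enc \<eta>)" for \<eta>
  define K where "K \<eta> = map_pmf (gen \<eta>) (uniform_bits (\<rho> \<eta>))" for \<eta>
  have E: "set_pmf (E \<eta>) \<subseteq> bitstrings (n \<eta>)" for \<eta>
    using assms(6) by (auto simp: E_def encoded_input_def set_uniform_bits)
  have K: "set_pmf (K \<eta>) \<subseteq> bitstrings (\<kappa> \<eta>)" for \<eta>
    using assms(5) by (auto simp: K_def set_uniform_bits)
  from assms(10) obtain p :: "nat poly" and G0 where
    G0: "\<And>\<eta>. length (G0 \<eta>) \<le> poly p \<eta>"
      "\<And>\<eta> k x. k \<in> bitstrings (\<kappa> \<eta>) \<Longrightarrow> x \<in> bitstrings (n \<eta>) \<Longrightarrow> f \<eta> k x = maj_thr (G0 \<eta>) (k @ x)"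
    unfolding evaluated_by_maj_thr_def by metis
  define G where "G \<eta> = G0 \<eta> @ G0 \<eta> @ [(\<lambda>_. 0, 0)]" for \<eta>
  define s where "s \<eta> = length (G \<eta>)" for \<eta>
  define S where "S \<eta> = 2 * poly p \<eta> + 1" for \<eta>
  \<comment> \<open>This gives \<open>q / (4 s^2) \<ge> \<eta>\<close>, hence the decay
    \<open>exp (- \<eta>)\<close> in the union bound. \<open>Suc\<close> keeps \<open>q\<close>
    positive at 0.\<close>
  define q where "q \<eta> = 4 * (S \<eta>)\<^sup>2 * Suc \<eta>" for \<eta>
  have s_le: "s \<eta> \<le> S \<eta>" for \<eta>
    using G0(1)[of \<eta>] by (simp add: s_def S_def G_def)
  have s_pos: "1 \<le> s \<eta>" for \<eta>
    by (simp add: s_def G_def)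
  have S_bounded: "poly_bounded S" and q_bounded: "poly_bounded q"
    unfolding S_def[abs_def] q_def[abs_def] by (intro poly_bounded_intros)+
  have s_bounded: "poly_bounded s"
    using S_bounded s_le by (rule poly_bounded_mono)
  have q_pos: "0 < q \<eta>" for \<eta>
    by (simp add: q_def S_def)

  \<comment> \<open>A heaviest set of at most \<open>q\<close> points exists because there are
    finitely many candidates. Non-concentration applied to these sets yields
    \<open>c\<close>.\<close>
  have "\<exists>A. A \<subseteq> bitstrings (n \<eta>) \<and> card A \<le> q \<eta> \<and>
      (\<forall>B. B \<subseteq> bitstrings (n \<eta>) \<and> card B \<le> q \<eta> \<longrightarrow> measure_pmf.prob (E \<eta>) (- A) \<le> measure_pmf.prob (E \<eta>) (- B))" for \<eta>
  proof -
    let ?\<A> = "{A. A \<subseteq> bitstrings (n \<eta>) \<and> card A \<le> q \<eta>}"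
    have "finite ?\<A>"
      by (rule finite_subset[of _ "Pow (bitstrings (n \<eta>))"]) (auto simp: finite_bitstrings)
    moreover have "?\<A> \<noteq> {}"
      by (auto intro!: exI[of _ "{}"])
    ultimately show ?thesis
      using arg_min_if_finite[of ?\<A> "\<lambda>A. measure_pmf.prob (E \<eta>) (- A)"] by (metis (mono_tags, lifting) mem_Collect_eq not_le)
  qed
  then obtain H where H: "\<And>\<eta>. H \<eta> \<subseteq> bitstrings (n \<eta>)" "\<And>\<eta>. card (H \<eta>) \<le> q \<eta>"
    "\<And>\<eta> B. B \<subseteq> bitstrings (n \<eta>) \<Longrightarrow> card B \<le> q \<eta> \<Longrightarrow> measure_pmf.prob (E \<eta>) (- H \<eta>) \<le> measure_pmf.prob (E \<eta>) (- B)"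
    by metis
  have "\<not> negligible_fun (\<lambda>\<eta>. measure_pmf.prob (E \<eta>) (- H \<eta>))"
  proof
    assume "negligible_fun (\<lambda>\<eta>. measure_pmf.prob (E \<eta>) (- H \<eta>))"
    moreover obtain pq :: "nat poly" where "\<And>\<eta>. q \<eta> \<le> poly pq \<eta>"
      using q_bounded unfolding poly_bounded_def by blast
    then have "\<forall>\<eta>. finite (H \<eta>) \<and> card (H \<eta>) \<le> poly pq \<eta>"
      using H(1,2) finite_bitstrings by (meson finite_subset le_trans)
    ultimately have "poly_concentrated E"
      unfolding poly_concentrated_def by blast
    then show False
      using assms(11) by (simp add: E_def[abs_def])
  qed
  then obtain c where c: "\<exists>\<^sub>F \<eta> in sequentially. 1 / real \<eta> ^ c \<le> measure_pmf.prob (E \<eta>) (- H \<eta>)"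
    unfolding negligible_fun_def by (auto simp: not_eventually not_less)
  \<comment> \<open>With \<open>\<delta> = 1 / \<eta>^c\<close>, this is the number of samples for
    which \<open>N \<delta> = 2 q\<close>.\<close>
  define N where "N \<eta> = 2 * q \<eta> * \<eta> ^ c" for \<eta>
  have N_bounded: "poly_bounded N"
    unfolding N_def[abs_def] by (intro poly_bounded_intros q_bounded)
  have "poly_bounded (\<lambda>\<eta>. N \<eta> + test_size (n \<eta>) (N \<eta>) (q \<eta>) (s \<eta>) + 1)"
    by (intro poly_bounded_intros poly_bounded_test_size assms(1) N_bounded q_bounded s_bounded)
  then obtain t :: "nat poly" where t: "\<And>\<eta>. N \<eta> + test_size (n \<eta>) (N \<eta>) (q \<eta>) (s \<eta>) + 1 \<le> poly t \<eta>"
    unfolding poly_bounded_def by blast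

  have "(\<lambda>\<eta>. real (S \<eta> * Suc (N \<eta>)) * exp (- real \<eta>)) \<longlonglongrightarrow> 0"
    by (intro poly_bounded_times_exp_tendsto poly_bounded_intros S_bounded N_bounded)
  then have small: "\<forall>\<^sub>F \<eta> in sequentially. real (S \<eta> * Suc (N \<eta>)) * exp (- real \<eta>) < 1 / 4"
    by (rule order_tendstoD) simp

  have distinguish: "\<exists>C. length C \<le> poly t \<eta> \<and> 1 / 4 \<le>
      \<bar>pmf (bind_pmf (K \<eta>) (\<lambda>k. run_circuit (example_oracle (m (n \<eta>)) (enc \<eta>) (f \<eta> k)) C)) True
       - pmf (bind_pmf (random_function (n \<eta>)) (\<lambda>\<psi>. run_circuit (example_oracle (m (n \<eta>)) (enc \<eta>) \<psi>) C)) True\<bar>"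
    if \<eta>: "1 / real \<eta> ^ c \<le> measure_pmf.prob (E \<eta>) (- H \<eta>)" "0 < \<eta>"
      and small: "real (S \<eta> * Suc (N \<eta>)) * exp (- real \<eta>) < 1 / 4" for \<eta>
  proof -
    have odd: "odd (length (G \<eta>))"
      by (simp add: G_def)
    have maj: "f \<eta> k x = maj_thr (G \<eta>) (k @ x)"
      if "k \<in> bitstrings (\<kappa> \<eta>)" "x \<in> bitstrings (n \<eta>)" for k x
      using G0(2)[OF that] by (simp add: G_def maj_thr_odd)
    \<comment> \<open>No set of fewer than \<open>q\<close> points carries more mass than
      \<open>H\<close>; points that are not bit strings of length \<open>n\<close> carry none and
      are cut off.\<close>
    have heavy: "1 / real \<eta> ^ c \<le> measure_pmf.prob (E \<eta>) (- A)" if "finite A" "card A < q \<eta>" for A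
    proof -
      have "card (A \<inter> bitstrings (n \<eta>)) \<le> q \<eta>"
        using card_mono[of A "A \<inter> bitstrings (n \<eta>)"] that by auto
      then have "measure_pmf.prob (E \<eta>) (- H \<eta>) \<le> measure_pmf.prob (E \<eta>) (- (A \<inter> bitstrings (n \<eta>)))"
        by (intro H(3)) auto
      also have "\<dots> \<le> measure_pmf.prob (E \<eta>) (- A)"
        using E[of \<eta>] by (intro measure_pmf.finite_measure_mono_AE) (auto simp: AE_measure_pmf_iff)
      finally show ?thesis
        using \<eta>(1) by linarith
    qed
    have enough: "2 * real (q \<eta>) \<le> real (N \<eta>) * (1 / real \<eta> ^ c)"
      using \<eta>(2) by (simp add: N_def)
    have tail: "real (length (G \<eta>)) * real (Suc (N \<eta>)) * exp (- real (q \<eta>) / (4 * (real (length (G \<eta>)))\<^sup>2)) \<le> 1 / 4"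
    proof -
      have "4 * (s \<eta>)\<^sup>2 * \<eta> \<le> 4 * (S \<eta>)\<^sup>2 * Suc \<eta>"
        using s_le by (intro mult_le_mono power_mono) auto
      then have "real (4 * (s \<eta>)\<^sup>2 * \<eta>) \<le> real (q \<eta>)"
        unfolding q_def by (rule of_nat_mono)
      then have "real \<eta> \<le> real (q \<eta>) / (4 * (real (s \<eta>))\<^sup>2)"
        using s_pos[of \<eta>] by (simp add: field_simps)
      then have "real (s \<eta>) * real (Suc (N \<eta>)) * exp (- real (q \<eta>) / (4 * (real (s \<eta>))\<^sup>2))
          \<le> real (S \<eta>) * real (Suc (N \<eta>)) * exp (- real \<eta>)"
        using s_le[of \<eta>] by (intro mult_mono) auto
      then show ?thesis
        using small unfolding s_def[symmetric] of_nat_mult by linarith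
    qed
    have nonneg: "0 \<le> 1 / real \<eta> ^ c"
      by simp
    obtain C where C: "length C \<le> N \<eta> + test_size (n \<eta>) (N \<eta>) (q \<eta>) (length (G \<eta>)) + 1"
      "1 / 4 \<le> \<bar>pmf (bind_pmf (K \<eta>) (\<lambda>k. run_circuit (map_pmf (\<lambda>x. x @ [f \<eta> k x]) (E \<eta>)) C)) True
       - pmf (bind_pmf (random_function (n \<eta>)) (\<lambda>\<psi>. run_circuit (map_pmf (\<lambda>x. x @ [\<psi> x]) (E \<eta>)) C)) True\<bar>"
      by (rule distinguisher[OF E K odd maj nonneg heavy enough q_pos tail])
    have "length C \<le> poly t \<eta>"
      using C(1) t[of \<eta>] unfolding s_def by (rule le_trans)
    with C(2) show ?thesis
      unfolding example_oracle_def E_def by (intro exI[of _ C] conjI)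
  qed

  show ?thesis
  proof (intro exI[of _ t] allI impI notI)
    fix \<epsilon>
    assume \<epsilon>: "negligible_fun \<epsilon>" and
      weak_prf: "encoded_input_weak_prf (poly t) \<epsilon> n (\<lambda>\<eta>. m (n \<eta>)) f (\<lambda>\<eta>. map_pmf (gen \<eta>) (uniform_bits (\<rho> \<eta>))) enc"
    \<comment> \<open>The advantage 1/4 is constant, so exponent 1 and \<open>\<eta> \<ge> 4\<close>
      suffice. Non-concentration holds only for infinitely many \<open>\<eta>\<close>, one of which
      satisfies the eventual conditions.\<close>
    have "\<forall>\<^sub>F \<eta> in sequentially. \<bar>\<epsilon> \<eta>\<bar> < 1 / real \<eta> ^ 1"
      using \<epsilon> unfolding negligible_fun_def by blast
    then have "\<forall>\<^sub>F \<eta> in sequentially. \<bar>\<epsilon> \<eta>\<bar> < 1 / real \<eta> ^ 1 \<and> 4 \<le> \<eta> \<and> real (S \<eta> * Suc (N \<eta>)) * exp (- real \<eta>) < 1 / 4"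
      using small eventually_ge_at_top[of 4] by (simp add: eventually_conj_iff)
    from frequently_eventually_frequently[OF c this]
    obtain \<eta> where \<eta>: "1 / real \<eta> ^ c \<le> measure_pmf.prob (E \<eta>) (- H \<eta>)" "\<bar>\<epsilon> \<eta>\<bar> < 1 / real \<eta> ^ 1"
      "4 \<le> \<eta>" "real (S \<eta> * Suc (N \<eta>)) * exp (- real \<eta>) < 1 / 4"
      by (auto dest: frequently_ex)
    then obtain C where C: "length C \<le> poly t \<eta>" "1 / 4 \<le>
      \<bar>pmf (bind_pmf (K \<eta>) (\<lambda>k. run_circuit (example_oracle (m (n \<eta>)) (enc \<eta>) (f \<eta> k)) C)) True
       - pmf (bind_pmf (random_function (n \<eta>)) (\<lambda>\<psi>. run_circuit (example_oracle (m (n \<eta>)) (enc \<eta>) \<psi>) C)) True\<bar>"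
      using distinguish[of \<eta>] by auto
    then have "1 / 4 \<le> \<epsilon> \<eta>"
      using weak_prf unfolding encoded_input_weak_prf_def K_def by (meson order_trans)
    moreover have "1 / real \<eta> \<le> 1 / 4"
      using \<eta>(3) by (intro divide_left_mono) auto
    ultimately show False
      using \<eta>(2) by simp
  qed
qed

end
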